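(* Let $(\Omega,\mathscr F,\mathbb P)$ be a probability space, let $(\mathcal Y,\lVert\cdot\rVert_{\mathcal Y})$ be a separable $\mathbb R$-Banach space, let $\mathfrak z,\mathfrak B,\kappa,C,c\in[1,\infty)$, $\Theta=\bigcup_{n=1}^\infty\mathbb Z^n$, $(M_j)_{j\in\mathbb N}\subseteq\mathbb N$, $y\in\mathcal Y$ satisfy $\liminf_{j\to\infty}M_j=\infty$, $\sup_{j\in\mathbb N}M_{j+1}/M_j\le\mathfrak B$, and $\sup_{j\in\mathbb N}M_j/j\le\kappa$. Let $(\mathcal Z,\mathscr Z)$ be a measurable space, let $Z^\theta\colon\Omega\to\mathcal Z$, $\theta\in\Theta$, be i.i.d. $\mathscr F/\mathscr Z$-measurable functions, let $(\mathcal H,\langle\cdot,\cdot\rangle_{\mathcal H},\lVert\cdot\rVert_{\mathcal H})$ be a separable $\mathbb R$-Hilbert space, let $\mathscr S$ be the strong $\sigma$-algebra on $L(\mathcal Y,\mathcal H)$, let $\psi_k\colon\Omega\to L(\mathcal Y,\mathcal H)$, $k\in\mathbb N_0$, be $\mathscr F/\mathscr S$-measurable functions, and assume that $(Z^\theta)_{\theta\in\Theta}$ and $(\psi_k)_{k\in\mathbb N_0}$ are independent. Let $\Phi_l\colon\mathcal Y\times\mathcal Y\times\mathcal Z\to\mathcal Y$, $l\in\mathbb N_0$, be $(\mathscr B(\mathcal Y)\otimes\mathscr B(\mathcal Y)\otimes\mathscr Z)/\mathscr B(\mathcal Y)$-measurable functions. Let $Y^\theta_{n,j}\colon\Omega\to\mathcal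 Y$, $\theta\in\Theta$, $j\in\mathbb N$, $n\in\mathbb N_0\cup\{-1\}$, satisfy for all $n,j\in\mathbb N$, $\theta\in\Theta$ that $Y^\theta_{-1,j}=Y^\theta_{0,j}=0$ and $$Y^\theta_{n,j}=\sum_{l=0}^{n-1}\frac1{(M_j)^{n-l}}\Biggl[\sum_{i=1}^{(M_j)^{n-l}}\Phi_l\bigl(Y^{(\theta,l,i)}_{l,j},Y^{(\theta,-l,i)}_{l-1,j},Z^{(\theta,l,i)}\bigr)\Biggr].$$ Let $(\mathrm{Cost}_{n,j})_{(n,j)\in(\mathbb N_0\cup\{-1\})\times\mathbb N}\subseteq[0,\infty)$ satisfy for all $n,j\in\mathbb N$ that $\mathrm{Cost}_{-1,j}=\mathrm{Cost}_{0,j}=0$ and $$\mathrm{Cost}_{n,j}\le(M_j)^n\mathfrak z+\sum_{l=0}^{n-1}\bigl[(M_j)^{n-l}(\mathrm{Cost}_{l,j}+\mathrm{Cost}_{l-1,j}+2\mathfrak z)\bigr].$$ Assume for all $k\in\mathbb N_0$, $n,j\in\mathbb N$, $u,v\in\mathcal Y$ that $\mathbb E[\lVert\Phi_k(Y^0_{k,j},Y^1_{k-1,j},Z^0)\rVert_{\mathcal Y}]<\infty$ and $$\max\bigl\{\mathbb E[\lVert\psi_k(\Phi_0(0,0,Z^0))\rVert_{\mathcal H}^2],\ \mathbb E[\lVert\psi_k(y)\rVert_{\mathcal H}^2]\bigr\}\le\frac{C^2}{k!},$$ $$\mathbb E[\lVert\psi_k(\Phi_n(u,v,Z^0))\rVert_{\mathcal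 H}^2]\le c\,\mathbb E[\lVert\psi_{k+1}(u-v)\rVert_{\mathcal H}^2],$$ $$\mathbb E\Bigl[\Bigl\lVert\psi_k\Bigl(y-\sum_{l=0}^{n-1}\mathbb E\bigl[\Phi_l(Y^0_{l,j},Y^1_{l-1,j},Z^0)\bigr]\Bigr)\Bigr\rVert_{\mathcal H}^2\Bigr]\le c\,\mathbb E\bigl[\lVert\psi_{k+1}(Y^0_{n-1,j}-y)\rVert_{\mathcal H}^2\bigr].$$ Then (i) for all $n\in\mathbb N$ it holds that $\bigl(\mathbb E[\lVert\psi_0(Y^0_{n,n}-y)\rVert_{\mathcal H}^2]\bigr)^{1/2}\le C\bigl[\frac{8ce^\kappa}{M_n}\bigr]^{n/2}<\infty$; (ii) for all $n\in\mathbb N$ it holds that $\mathrm{Cost}_{n,n}\le(5M_n)^n\mathfrak z$; and (iii) there exists $(N_\varepsilon)_{\varepsilon\in(0,1]}\subseteq\mathbb N$ such that for all $\varepsilon\in(0,1]$, $\delta\in(0,\infty)$ it holds that $\sup_{n\in\{N_\varepsilon,N_\varepsilon+1,\ldots\}}\bigl(\mathbb E[\lVert\psi_0(Y^0_{n,n}-y)\rVert_{\mathcal H}^2]\bigr)^{1/2}\le\varepsilon$ and $$\mathrm{Cost}_{N_\varepsilon,N_\varepsilon}\le5\,\mathfrak z\,e^\kappa C^{2(1+\delta)}\Bigl(1+\sup_{n\in\mathbb N}\bigl[(M_n)^{-\delta}(40ce^{2\kappa}\mathfrak B)^{(1+\delta)}\bigr]^n\Bigr)\varepsilon^{-2(1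+\delta)}<\infty.$$
   Context: $\mathbb N=\{1,2,3,\ldots\}$, $\mathbb N_0=\{0,1,2,\ldots\}$. For $\theta\in\mathbb Z^k\subseteq\Theta$ and $l,i\in\mathbb Z$, $(\theta,l,i)$ denotes the concatenated tuple in $\mathbb Z^{k+2}\subseteq\Theta$; the superscripts $0$ and $1$ denote the elements $0,1\in\mathbb Z^1\subseteq\Theta$. $\mathscr B(\cdot)$ is the Borel $\sigma$-algebra. $L(\mathcal Y,\mathcal H)$ is the space of continuous linear maps from $\mathcal Y$ to $\mathcal H$, and the strong $\sigma$-algebra on it is the $\sigma$-algebra generated by the sets $\{\varphi\in L(\mathcal Y,\mathcal H)\colon\varphi(x)\in\mathcal B\}$, $x\in\mathcal Y$, $\mathcal B\in\mathscr B(\mathcal H)$. For $\psi\colon\Omega\to L(\mathcal Y,\mathcal H)$ and $X\colon\Omega\to\mathcal Y$, $\psi(X)$ denotes the map $\omega\mapsto[\psi(\omega)](X(\omega))$. Expectations of $\mathcal Y$-valued random variables are Bochner integrals. *)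

theory Defs
  imports "HOL-Probability.Probability"
begin

definition Theta :: "int list set" where
  "Theta = {\<theta>. \<theta> \<noteq> []}"

definition strong_algebra ::
    "('y::real_normed_vector \<Rightarrow>\<^sub>L 'h::real_normed_vector) measure" where
  "strong_algebra =
     sigma UNIV {{\<phi>. blinfun_apply \<phi> x \<in> B} | x B. B \<in> sets borel}"

definition generated_sets ::
    "'w measure \<Rightarrow> 'i set \<Rightarrow> 'a measure \<Rightarrow> ('i \<Rightarrow> 'w \<Rightarrow> 'a) \<Rightarrow> 'w set set" where
  "generated_sets P I N X =
     sigma_sets (space P) (\<Union>i\<in>I. {X i -` A \<inter> space P | A. A \<in> sets N})"

definition iid_family ::
    "'w measure \<Rightarrow> 'i set \<Rightarrow> 'a measure \<Rightarrow> ('i \<Rightarrow> 'w \<Rightarrow> 'a) \<Rightarrow> bool" where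
  "iid_family P I N X \<longleftrightarrow>
     prob_space.indep_vars P (\<lambda>_. N) X I \<and>
     (\<forall>i\<in>I. \<forall>j\<in>I. distr P N (X i) = distr P N (X j))"

text \<open>Second moments of norms are taken in \<^typ>\<open>ennreal\<close>, so that an infinite second moment
  is not identified with the value 0 that the Bochner integral gives to non-integrable functions.\<close>

definition second_moment :: "'w measure \<Rightarrow> ('w \<Rightarrow> 'h::real_normed_vector) \<Rightarrow> ennreal" where
  "second_moment P X = (\<integral>\<^sup>+ \<omega>. ennreal ((norm (X \<omega>))\<^sup>2) \<partial>P)"

definition ennsqrt :: "ennreal \<Rightarrow> ennreal" where
  "ennsqrt x = (if x = \<top> then \<top> else ennreal (sqrt (enn2real x)))"

end

theory Submission
  imports Defs
begin

text \<open>
  Since \<open>\<psi>\<^sub>k\<close> is independent of the family \<open>Z\<close>, second moments of \<open>\<psi>\<^sub>k(X)\<close> for \<open>Z\<close>-measurable \<open>X\<close> are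
  expectations of \<open>q\<^sub>k(X)\<close> with the deterministic function \<open>q\<^sub>k(x) = E \<parallel>\<psi>\<^sub>k(x)\<parallel>\<^sup>2\<close>. The Hilbert space structure
  enters only through the bias-variance inequality \<open>E q\<^sub>k(a + s X) \<le> q\<^sub>k(a + s E X) + s\<^sup>2 E q\<^sub>k(X)\<close>.
  All summands of the scheme are independent and, within a level, identically distributed. With
  \<open>e k n = E q\<^sub>k(Y\<^sub>n - y)\<close> this gives
  \<open>e k n \<le> c e (k + 1) (n - 1) + M\<^sup>-\<^sup>n C\<^sup>2 / k! + \<Sum>\<^sub>0\<^sub><\<^sub>l\<^sub><\<^sub>n M\<^sup>l\<^sup>-\<^sup>n 2 c (e (k + 1) l + e (k + 1) (l - 1))\<close>,
  which is solved by \<open>C\<^sup>2 (8 c / M)\<^sup>n S\<^sub>k\<close> with \<open>S\<^sub>k = \<Sum>\<^sub>i M\<^sup>i / (k + i)!\<close>, because \<open>M S\<^sub>k\<^sub>+\<^sub>1 + 1 / k! = S\<^sub>k\<close>;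
  finally \<open>S\<^sub>0 = exp M \<le> exp (\<kappa> n)\<close> for \<open>M = M\<^sub>n\<close>. For the complexity bound take the least level from
  which on the error bound stays below \<open>\<epsilon>\<close>; the error bound of the preceding level exceeds \<open>\<epsilon>\<close>, which
  controls the cost from above.
\<close>

section \<open>Random continuous linear maps\<close>

lemma space_strong_algebra [simp]: "space strong_algebra = UNIV"
  by (simp add: strong_algebra_def space_measure_of_conv)

lemma measurable_strong_algebra_apply [measurable]:
  "(\<lambda>\<phi>. blinfun_apply \<phi> x) \<in> borel_measurable strong_algebra"
proof (rule measurableI)
  fix B :: "'b set"
  assume "B \<in> sets borel"
  then show "(\<lambda>\<phi>. blinfun_apply \<phi> x) -` B \<inter> space strong_algebra \<in> sets strong_algebra"
    unfolding strong_algebra_def by (auto simp: space_measure_of_conv vimage_def)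
qed simp

text \<open>A Caratheodory argument: approximate the second argument by simple functions.\<close>

lemma measurable_strong_algebra_eval:
  fixes f :: "'a \<Rightarrow> 'y::{real_normed_vector, second_countable_topology}"
    and g :: "'a \<Rightarrow> 'y \<Rightarrow>\<^sub>L 'h::real_normed_vector"
  assumes g: "g \<in> measurable N strong_algebra" and f: "f \<in> borel_measurable N"
  shows "(\<lambda>x. blinfun_apply (g x) (f x)) \<in> borel_measurable N"
proof -
  obtain s where s: "\<And>i. simple_function N (s i)"
    and lim: "\<And>x. x \<in> space N \<Longrightarrow> (\<lambda>i. s i x) \<longlonglongrightarrow> f x"
    using borel_measurable_implies_sequence_metric[OF f, of 0] by blast
  show ?thesis
  proof (rule borel_measurable_LIMSEQ_metric)
    fix i
    have fin: "finite (s i ` space N)"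
      using s by (auto simp: simple_function_def)
    have si: "s i \<in> measurable N (count_space (s i ` space N))"
      using s[of i] fin
      by (subst measurable_count_space_eq2) (auto simp: simple_function_def)
    have gv: "(\<lambda>x. blinfun_apply (g x) v) \<in> borel_measurable N" for v
      using g measurable_strong_algebra_apply by (rule measurable_compose)
    show "(\<lambda>x. blinfun_apply (g x) (s i x)) \<in> borel_measurable N"
      by (rule measurable_compose_countable'[where f = "\<lambda>v x. blinfun_apply (g x) v", OF gv si countable_finite[OF fin]])
  next
    fix x assume "x \<in> space N"
    then show "(\<lambda>i. blinfun_apply (g x) (s i x)) \<longlonglongrightarrow> blinfun_apply (g x) (f x)"
      by (rule blinfun.tendsto[OF tendsto_const lim])
  qed
qed

section \<open>Mean squares of a random linear map at a deterministic argument\<close>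

definition mean_sq :: "('y::real_normed_vector \<Rightarrow>\<^sub>L 'h::real_normed_vector) measure \<Rightarrow> 'y \<Rightarrow> ennreal"
  where "mean_sq \<nu> x = (\<integral>\<^sup>+ \<phi>. ennreal ((norm (blinfun_apply \<phi> x))\<^sup>2) \<partial>\<nu>)"

lemma mean_sq_minus: "mean_sq \<nu> (- x) = mean_sq \<nu> x"
  by (simp add: mean_sq_def blinfun.minus_right)

lemma mean_sq_minus_commute: "mean_sq \<nu> (x - y) = mean_sq \<nu> (y - x)"
  using mean_sq_minus[of \<nu> "y - x"] by simp

text \<open>Follows from \<open>u - v = (u - y) - (v - y)\<close> and norm(a - b)^2 \<le> 2
  norm(a)^2 + 2 norm(b)^2 for each fixed map. In the scheme, \<open>u\<close> and \<open>v\<close>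
  are approximations of consecutive levels and \<open>y\<close> is their common target.\<close>

lemma mean_sq_diff_le:
  assumes "sets \<nu> = sets strong_algebra"
  shows "mean_sq \<nu> (u - v) \<le> 2 * mean_sq \<nu> (u - y) + 2 * mean_sq \<nu> (v - y)"
proof -
  have [measurable]: "(\<lambda>\<phi>. blinfun_apply \<phi> x) \<in> borel_measurable \<nu>" for x
    using measurable_strong_algebra_apply by (simp add: measurable_cong_sets[OF assms refl])
  have "(norm (a - b))\<^sup>2 \<le> 2 * (norm a)\<^sup>2 + 2 * (norm b)\<^sup>2" for a b :: 'b
  proof -
    have "(norm (a - b))\<^sup>2 \<le> (norm a + norm b)\<^sup>2"
      by (intro power_mono norm_triangle_ineq4) auto
    also have "\<dots> \<le> 2 * (norm a)\<^sup>2 + 2 * (norm b)\<^sup>2"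
      using sum_squares_bound[of "norm a" "norm b"] by (simp add: power2_sum)
    finally show ?thesis .
  qed
  from this[of "blinfun_apply \<phi> (u - y)" "blinfun_apply \<phi> (v - y)" for \<phi>]
  have "(norm (blinfun_apply \<phi> (u - v)))\<^sup>2
      \<le> 2 * (norm (blinfun_apply \<phi> (u - y)))\<^sup>2 + 2 * (norm (blinfun_apply \<phi> (v - y)))\<^sup>2"
    for \<phi> :: "'a \<Rightarrow>\<^sub>L 'b"
    by (simp flip: blinfun.diff_right)
  then have "ennreal ((norm (blinfun_apply \<phi> (u - v)))\<^sup>2)
      \<le> ennreal (2 * (norm (blinfun_apply \<phi> (u - y)))\<^sup>2 + 2 * (norm (blinfun_apply \<phi> (v - y)))\<^sup>2)"
    for \<phi> :: "'a \<Rightarrow>\<^sub>L 'b"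
    by (rule ennreal_leI)
  also have "ennreal (2 * p\<^sup>2 + 2 * r\<^sup>2) = 2 * ennreal (p\<^sup>2) + 2 * ennreal (r\<^sup>2)" for p r :: real
    by (simp add: ennreal_plus ennreal_mult)
  finally have "mean_sq \<nu> (u - v) \<le> (\<integral>\<^sup>+ \<phi>. 2 * ennreal ((norm (blinfun_apply \<phi> (u - y)))\<^sup>2)
      + 2 * ennreal ((norm (blinfun_apply \<phi> (v - y)))\<^sup>2) \<partial>\<nu>)"
    unfolding mean_sq_def by (rule nn_integral_mono)
  also have "\<dots> = 2 * mean_sq \<nu> (u - y) + 2 * mean_sq \<nu> (v - y)"
  proof -
    have "(\<integral>\<^sup>+ \<phi>. 2 * ennreal ((norm (blinfun_apply \<phi> x))\<^sup>2) \<partial>\<nu>) = 2 * mean_sq \<nu> x" for x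
      unfolding mean_sq_def by (rule nn_integral_cmult) measurable
    then show ?thesis by (subst nn_integral_add) auto
  qed
  finally show ?thesis .
qed

text \<open>Expanding the square shows that the two sides differ by
  \<open>(norm (E \<phi>(s x)))\<^sup>2\<close> for every fixed \<open>\<phi>\<close>.\<close>

lemma nn_integral_norm_sq_shift_le:
  fixes \<phi> :: "'y::{banach, second_countable_topology} \<Rightarrow>\<^sub>L 'h::{real_inner, banach, second_countable_topology}"
  assumes "prob_space D" and D: "sets D = sets borel" and int: "integrable D (\<lambda>x. x)"
  shows "(\<integral>\<^sup>+ x. ennreal ((norm (blinfun_apply \<phi> (a + s *\<^sub>R x)))\<^sup>2) \<partial>D)
    \<le> ennreal ((norm (blinfun_apply \<phi> (a + s *\<^sub>R (\<integral>x. x \<partial>D))))\<^sup>2)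
      + ennreal (s\<^sup>2) * (\<integral>\<^sup>+ x. ennreal ((norm (blinfun_apply \<phi> x))\<^sup>2) \<partial>D)"
proof -
  interpret prob_space D by fact
  have [measurable]: "blinfun_apply \<phi> \<in> borel_measurable D"
    using D by (auto intro!: borel_measurable_continuous_onI continuous_intros
      simp: measurable_cong_sets[OF D refl])
  define T where "T = (\<integral>\<^sup>+ x. ennreal ((norm (blinfun_apply \<phi> x))\<^sup>2) \<partial>D)"
  show ?thesis
  \<comment> \<open>If \<open>T\<close> is infinite and \<open>s\<close> is nonzero, the right-hand
    side is infinite. If \<open>s = 0\<close>, both sides coincide because 0 times infinity is 0 in
    \<open>ennreal\<close>. Only in the remaining case is the square expanded with Bochner
    integrals.\<close>
  proof (cases "s = 0 \<or> T < \<top>")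
    case False
    then have "ennreal (s\<^sup>2) * T = \<top>"
      using top.not_eq_extremum[of T] by (simp add: ennreal_mult_eq_top_iff)
    then show ?thesis
      by (simp add: T_def)
  next
    case True
    then consider "s = 0" | "T < \<top>" by blast
    then show ?thesis
    proof cases
      case 1
      then show ?thesis by (simp add: emeasure_space_1)
    next
      case 2
      then have sq: "integrable D (\<lambda>x. (norm (blinfun_apply \<phi> x))\<^sup>2)"
        unfolding T_def by (intro integrableI_bounded) auto
      have lin: "integrable D (\<lambda>x. blinfun_apply \<phi> x)"
        using blinfun.bounded_linear_right int by (rule integrable_bounded_linear)
      have mean: "(\<integral>x. blinfun_apply \<phi> x \<partial>D) = blinfun_apply \<phi> (\<integral>x. x \<partial>D)"
        using blinfun.bounded_linear_right int by (rule integral_bounded_linear)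
      have expand: "(norm (blinfun_apply \<phi> (a + s *\<^sub>R x)))\<^sup>2 = (norm (blinfun_apply \<phi> a))\<^sup>2
          + 2 * s * (blinfun_apply \<phi> a \<bullet> blinfun_apply \<phi> x) + s\<^sup>2 * (norm (blinfun_apply \<phi> x))\<^sup>2" for x
        unfolding power2_norm_eq_inner
        by (simp add: blinfun.add_right blinfun.scaleR_right inner_add_left inner_add_right
          inner_commute power2_eq_square algebra_simps)
      have "(\<integral>\<^sup>+ x. ennreal ((norm (blinfun_apply \<phi> (a + s *\<^sub>R x)))\<^sup>2) \<partial>D)
          = ennreal (\<integral>x. (norm (blinfun_apply \<phi> (a + s *\<^sub>R x)))\<^sup>2 \<partial>D)"
      proof (rule nn_integral_eq_integral)
        show "integrable D (\<lambda>x. (norm (blinfun_apply \<phi> (a + s *\<^sub>R x)))\<^sup>2)"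
          unfolding expand using sq lin by simp
      qed simp
      also have "(\<integral>x. (norm (blinfun_apply \<phi> (a + s *\<^sub>R x)))\<^sup>2 \<partial>D)
          = (norm (blinfun_apply \<phi> a))\<^sup>2 + 2 * s * (blinfun_apply \<phi> a \<bullet> blinfun_apply \<phi> (\<integral>x. x \<partial>D))
            + s\<^sup>2 * (\<integral>x. (norm (blinfun_apply \<phi> x))\<^sup>2 \<partial>D)"
        unfolding expand using sq lin by (simp add: mean prob_space)
      also have "\<dots> \<le> (norm (blinfun_apply \<phi> (a + s *\<^sub>R (\<integral>x. x \<partial>D))))\<^sup>2
          + s\<^sup>2 * (\<integral>x. (norm (blinfun_apply \<phi> x))\<^sup>2 \<partial>D)"
        unfolding expand by simp
      also have "ennreal \<dots> = ennreal ((norm (blinfun_apply \<phi> (a + s *\<^sub>R (\<integral>x. x \<partial>D))))\<^sup>2)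
          + ennreal (s\<^sup>2) * ennreal (\<integral>x. (norm (blinfun_apply \<phi> x))\<^sup>2 \<partial>D)"
        by (simp add: ennreal_mult')
      also have "ennreal (\<integral>x. (norm (blinfun_apply \<phi> x))\<^sup>2 \<partial>D)
          = (\<integral>\<^sup>+ x. ennreal ((norm (blinfun_apply \<phi> x))\<^sup>2) \<partial>D)"
        using sq by (intro nn_integral_eq_integral[symmetric]) auto
      finally show ?thesis by (simp add: ennreal_leI)
    qed
  qed
qed

section \<open>Tonelli for random maps and the bias-variance inequality for independent sums\<close>

lemma measurable_norm_eval:
  assumes "sets \<nu> = sets strong_algebra" and "f \<in> borel_measurable D"
  shows "(\<lambda>(\<phi>, x). ennreal ((norm (blinfun_apply \<phi> (f x :: 'y::{banach, second_countable_topology})))\<^sup>2))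
    \<in> borel_measurable (\<nu> \<Otimes>\<^sub>M D)"
proof -
  have [measurable]: "fst \<in> measurable (\<nu> \<Otimes>\<^sub>M D) strong_algebra"
    using measurable_fst[of \<nu> D] by (simp add: measurable_cong_sets[OF refl assms(1)])
  \<comment> \<open>The strong sigma-algebra only provides evaluation at fixed points. Joint
    measurability in map and argument is what the Caratheodory argument adds, and Tonelli requires
    it.\<close>
  have [measurable]: "(\<lambda>p. blinfun_apply (fst p) (f (snd p))) \<in> borel_measurable (\<nu> \<Otimes>\<^sub>M D)"
    using assms(2) by (intro measurable_strong_algebra_eval) auto
  show ?thesis
    by (simp add: case_prod_beta)
qed

lemma mean_sq_measurable:
  fixes f :: "'a \<Rightarrow> 'y::{banach, second_countable_topology}"
  assumes "sigma_finite_measure \<nu>" and "sets \<nu> = sets strong_algebra" and "f \<in> borel_measurable N"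
  shows "(\<lambda>x. mean_sq \<nu> (f x)) \<in> borel_measurable N"
proof -
  interpret sigma_finite_measure \<nu> by fact
  have [measurable]: "snd \<in> measurable (N \<Otimes>\<^sub>M \<nu>) strong_algebra"
    using measurable_snd[of N \<nu>] by (simp add: measurable_cong_sets[OF refl assms(2)])
  have [measurable]: "(\<lambda>p. blinfun_apply (snd p) (f (fst p))) \<in> borel_measurable (N \<Otimes>\<^sub>M \<nu>)"
    using assms(3) by (intro measurable_strong_algebra_eval) auto
  show ?thesis
    unfolding mean_sq_def by (rule borel_measurable_nn_integral) (simp add: case_prod_beta)
qed

lemma nn_integral_mean_sq:
  fixes f :: "'a \<Rightarrow> 'y::{banach, second_countable_topology}"
  assumes "sigma_finite_measure \<nu>" and "sigma_finite_measure N"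
    and "sets \<nu> = sets strong_algebra" and "f \<in> borel_measurable N"
  shows "(\<integral>\<^sup>+ x. mean_sq \<nu> (f x) \<partial>N)
    = (\<integral>\<^sup>+ \<phi>. (\<integral>\<^sup>+ x. ennreal ((norm (blinfun_apply \<phi> (f x)))\<^sup>2) \<partial>N) \<partial>\<nu>)"
proof -
  interpret pair_sigma_finite \<nu> N
    using assms by (simp add: pair_sigma_finite_def)
  show ?thesis
    unfolding mean_sq_def by (rule Fubini'[OF measurable_norm_eval[OF assms(3,4)]])
qed

text \<open>The pointwise inequality for a fixed map is integrated over \<open>\<nu>\<close>.
  Tonelli exchanges the two integrals on the left and in the variance term on the right.\<close>

lemma mean_sq_shift_le:
  fixes \<nu> :: "('y::{banach, second_countable_topology} \<Rightarrow>\<^sub>L 'h::{real_inner, banach, second_countable_topology}) measure"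
  assumes \<nu>: "sigma_finite_measure \<nu>" "sets \<nu> = sets strong_algebra"
    and D: "prob_space D" "sets D = sets borel" "integrable D (\<lambda>x. x)"
  shows "(\<integral>\<^sup>+ x. mean_sq \<nu> (a + s *\<^sub>R x) \<partial>D)
    \<le> mean_sq \<nu> (a + s *\<^sub>R (\<integral>x. x \<partial>D)) + ennreal (s\<^sup>2) * (\<integral>\<^sup>+ x. mean_sq \<nu> x \<partial>D)"
proof -
  interpret D: prob_space D by fact
  interpret sigma_finite_measure \<nu> by fact
  note sf = \<nu>(1) D.sigma_finite_measure_axioms \<nu>(2)
  note [measurable] = borel_measurable_integrable[OF D(3)]
  have aff: "(\<lambda>x. a + s *\<^sub>R x) \<in> borel_measurable D"
    by (intro borel_measurable_add borel_measurable_const borel_measurable_scaleR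
      borel_measurable_integrable[OF D(3)])
  have [measurable]: "(\<lambda>\<phi>. blinfun_apply \<phi> x) \<in> borel_measurable \<nu>" for x
    using measurable_strong_algebra_apply by (simp add: measurable_cong_sets[OF \<nu>(2) refl])
  have inner: "(\<lambda>\<phi>. \<integral>\<^sup>+ x. ennreal ((norm (blinfun_apply \<phi> x))\<^sup>2) \<partial>D) \<in> borel_measurable \<nu>"
    by (rule D.borel_measurable_nn_integral)
      (rule measurable_norm_eval[OF \<nu>(2) borel_measurable_integrable[OF D(3)]])
  have "(\<integral>\<^sup>+ x. mean_sq \<nu> (a + s *\<^sub>R x) \<partial>D)
      \<le> (\<integral>\<^sup>+ \<phi>. ennreal ((norm (blinfun_apply \<phi> (a + s *\<^sub>R (\<integral>x. x \<partial>D))))\<^sup>2)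
      + ennreal (s\<^sup>2) * (\<integral>\<^sup>+ x. ennreal ((norm (blinfun_apply \<phi> x))\<^sup>2) \<partial>D) \<partial>\<nu>)"
    unfolding nn_integral_mean_sq[OF sf aff]
    by (intro nn_integral_mono nn_integral_norm_sq_shift_le[OF D])
  also have "\<dots> = mean_sq \<nu> (a + s *\<^sub>R (\<integral>x. x \<partial>D)) + ennreal (s\<^sup>2) * (\<integral>\<^sup>+ x. mean_sq \<nu> x \<partial>D)"
  proof -
    have "(\<integral>\<^sup>+ x. mean_sq \<nu> x \<partial>D)
        = (\<integral>\<^sup>+ \<phi>. \<integral>\<^sup>+ x. ennreal ((norm (blinfun_apply \<phi> x))\<^sup>2) \<partial>D \<partial>\<nu>)"
      by (rule nn_integral_mean_sq[OF sf borel_measurable_integrable[OF D(3)]])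
    then have "ennreal (s\<^sup>2) * (\<integral>\<^sup>+ x. mean_sq \<nu> x \<partial>D)
        = (\<integral>\<^sup>+ \<phi>. ennreal (s\<^sup>2) * (\<integral>\<^sup>+ x. ennreal ((norm (blinfun_apply \<phi> x))\<^sup>2) \<partial>D) \<partial>\<nu>)"
      by (simp add: nn_integral_cmult[OF inner])
    then show ?thesis
      unfolding mean_sq_def[of \<nu> "a + _"] using inner by (simp add: nn_integral_add)
  qed
  finally show ?thesis .
qed

text \<open>Induction over the coordinates: integrating out one of them replaces it by its mean and
  costs its variance term. The mean is absorbed into the offset \<open>a\<close>, which is therefore
  kept arbitrary.\<close>

lemma mean_sq_PiM_sum_le:
  fixes \<nu> :: "('y::{banach, second_countable_topology} \<Rightarrow>\<^sub>L 'h::{real_inner, banach, second_countable_topology}) measure"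
  assumes \<nu>: "sigma_finite_measure \<nu>" "sets \<nu> = sets strong_algebra"
    and D: "\<And>i. prob_space (D i)" "\<And>i. sets (D i) = sets borel" "\<And>i. integrable (D i) (\<lambda>x. x)"
    and "finite I"
  shows "(\<integral>\<^sup>+ w. mean_sq \<nu> (a + (\<Sum>i\<in>I. s i *\<^sub>R w i)) \<partial>PiM I D)
    \<le> mean_sq \<nu> (a + (\<Sum>i\<in>I. s i *\<^sub>R (\<integral>x. x \<partial>D i)))
      + (\<Sum>i\<in>I. ennreal ((s i)\<^sup>2) * (\<integral>\<^sup>+ x. mean_sq \<nu> x \<partial>D i))"
  using \<open>finite I\<close>
proof (induction I arbitrary: a)
  case empty
  interpret product_prob_space D "{}"
    using D(1) by (intro product_prob_spaceI) auto
  show ?case by (simp add: emeasure_space_1 P.emeasure_space_1)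
next
  case (insert b I)
  interpret product_prob_space D UNIV
    using D(1) by (intro product_prob_spaceI) auto
  have meas: "(\<lambda>w. w i) \<in> borel_measurable (PiM J D)" if "i \<in> J" for i J
    using measurable_component_singleton[OF that, of D] by (simp add: measurable_cong_sets[OF refl D(2)])
  have meas_sum: "(\<lambda>w. mean_sq \<nu> (a + (\<Sum>i\<in>K. s i *\<^sub>R w i))) \<in> borel_measurable (PiM J D)"
    if "K \<subseteq> J" for a K J
    by (intro mean_sq_measurable[OF \<nu>] borel_measurable_add borel_measurable_const
      borel_measurable_sum borel_measurable_scaleR meas) (use that in blast)
  let ?m = "\<lambda>i. \<integral>x. x \<partial>D i"
  let ?v = "\<lambda>i. \<integral>\<^sup>+ x. mean_sq \<nu> x \<partial>D i"
  have "(\<integral>\<^sup>+ w. mean_sq \<nu> (a + (\<Sum>i\<in>insert b I. s i *\<^sub>R w i)) \<partial>PiM (insert b I) D)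
      = (\<integral>\<^sup>+ w. \<integral>\<^sup>+ x. mean_sq \<nu> (a + (\<Sum>i\<in>insert b I. s i *\<^sub>R (w(b := x)) i)) \<partial>D b \<partial>PiM I D)"
    using insert.hyps
    by (intro product_nn_integral_insert meas_sum order_refl)
  also have "\<dots> = (\<integral>\<^sup>+ w. \<integral>\<^sup>+ x. mean_sq \<nu> ((a + (\<Sum>i\<in>I. s i *\<^sub>R w i)) + s b *\<^sub>R x) \<partial>D b \<partial>PiM I D)"
  proof -
    have "(\<Sum>i\<in>insert b I. s i *\<^sub>R (w(b := x)) i) = (\<Sum>i\<in>I. s i *\<^sub>R w i) + s b *\<^sub>R x"
      for w and x :: 'y
    proof -
      have "(\<Sum>i\<in>I. s i *\<^sub>R (w(b := x)) i) = (\<Sum>i\<in>I. s i *\<^sub>R w i)"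
        using insert.hyps by (intro sum.cong) auto
      then show ?thesis using insert.hyps by (simp add: add.commute)
    qed
    then show ?thesis by (simp only: add.assoc)
  qed
  also have "\<dots> \<le> (\<integral>\<^sup>+ w. mean_sq \<nu> ((a + s b *\<^sub>R ?m b) + (\<Sum>i\<in>I. s i *\<^sub>R w i))
      + ennreal ((s b)\<^sup>2) * ?v b \<partial>PiM I D)"
  \<comment> \<open>With the other coordinates \<open>w\<close> frozen, their weighted sum is part
    of a constant offset, and the inequality for a single variable applies.\<close>
  proof (rule nn_integral_mono)
    fix w
    show "(\<integral>\<^sup>+ x. mean_sq \<nu> ((a + (\<Sum>i\<in>I. s i *\<^sub>R w i)) + s b *\<^sub>R x) \<partial>D b)
      \<le> mean_sq \<nu> ((a + s b *\<^sub>R ?m b) + (\<Sum>i\<in>I. s i *\<^sub>R w i)) + ennreal ((s b)\<^sup>2) * ?v b"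
      using mean_sq_shift_le[OF \<nu> D(1)[of b] D(2)[of b] D(3)[of b],
          where a = "a + (\<Sum>i\<in>I. s i *\<^sub>R w i)" and s = "s b"]
      by (simp add: add_ac)
  qed
  also have "\<dots> = (\<integral>\<^sup>+ w. mean_sq \<nu> ((a + s b *\<^sub>R ?m b) + (\<Sum>i\<in>I. s i *\<^sub>R w i)) \<partial>PiM I D)
      + ennreal ((s b)\<^sup>2) * ?v b"
  proof -
    interpret PI: prob_space "PiM I D"
      using D(1) by (intro prob_space_PiM)
    show ?thesis
      by (subst nn_integral_add[OF meas_sum]) (simp_all add: PI.emeasure_space_1)
  qed
  \<comment> \<open>The induction hypothesis is used with the offset enlarged by the mean of
    coordinate \<open>b\<close>.\<close>
  also have "\<dots> \<le> mean_sq \<nu> ((a + s b *\<^sub>R ?m b) + (\<Sum>i\<in>I. s i *\<^sub>R ?m i))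
      + (\<Sum>i\<in>I. ennreal ((s i)\<^sup>2) * ?v i) + ennreal ((s b)\<^sup>2) * ?v b"
    by (intro add_right_mono insert.IH)
  finally show ?case
    using insert.hyps by (simp add: add_ac)
qed

lemma nn_integral_distr':
  assumes "T \<in> measurable M N" "f \<in> borel_measurable N"
  shows "(\<integral>\<^sup>+ x. f x \<partial>distr M N T) = (\<integral>\<^sup>+ x. f (T x) \<partial>M)"
  using assms by (simp add: nn_integral_distr)

section \<open>The law of the multilevel Picard scheme\<close>

text \<open>The noise \<open>w\<close> is indexed relative to the root, so that passing to a subtree
  is precomposition with a prefix. The truncated subtraction \<open>l - 1\<close> is harmless: for
  \<open>l = 0\<close> it gives level 0, whose value 0 is also the prescribed value at level
  -1.\<close>

fun mlp_val :: "(nat \<Rightarrow> 'y \<times> 'y \<times> 'z \<Rightarrow> 'y) \<Rightarrow> nat \<Rightarrow> nat \<Rightarrow> (int list \<Rightarrow> 'z) \<Rightarrow> 'y::real_vector"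
  where
  "mlp_val \<Phi> m n w = (\<Sum>l<n. (1 / real m ^ (n - l)) *\<^sub>R (\<Sum>i = 1..m ^ (n - l).
     \<Phi> l (mlp_val \<Phi> m l (\<lambda>\<eta>. w ([int l, int i] @ \<eta>)),
          mlp_val \<Phi> m (l - 1) (\<lambda>\<eta>. w ([- int l, int i] @ \<eta>)), w [int l, int i])))"

declare mlp_val.simps [simp del]

text \<open>A single summand with its position normalised: the indices (\<theta>, l, i) and
  (\<theta>, -l, i) become 0 and 1, as in the integrability and bias hypotheses.\<close>

definition mlp_term :: "(nat \<Rightarrow> 'y \<times> 'y \<times> 'z \<Rightarrow> 'y) \<Rightarrow> nat \<Rightarrow> nat \<Rightarrow> (int list \<Rightarrow> 'z) \<Rightarrow> 'y::real_vector"
  where "mlp_term \<Phi> m l w =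
    \<Phi> l (mlp_val \<Phi> m l (\<lambda>\<eta>. w (0 # \<eta>)), mlp_val \<Phi> m (l - 1) (\<lambda>\<eta>. w (1 # \<eta>)), w [0])"

definition mlp_dom :: "int list set"
  where "mlp_dom = {\<zeta>. \<zeta> \<noteq> [] \<and> hd \<zeta> \<in> {0, 1}}"

text \<open>The sign change of \<open>i\<close> for \<open>l = 0\<close> keeps the two subtrees apart; \<open>mlp_term\<close> does not depend
  on the second one in that case.\<close>

definition mlp_branch :: "int list \<Rightarrow> nat \<Rightarrow> nat \<Rightarrow> int list \<Rightarrow> int list"
  where "mlp_branch \<theta> l i \<zeta> = \<theta> @ [if hd \<zeta> = 0 then int l else - int l,
    if hd \<zeta> \<noteq> 0 \<and> l = 0 then - int i else int i] @ tl \<zeta>"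

section \<open>The scheme as a deterministic measurable functional of the noise\<close>

lemma mlp_val_0 [simp]: "mlp_val \<Phi> m 0 w = 0"
  by (subst mlp_val.simps) simp

text \<open>The recursion reads the noise only at indices of length at least two, even inside the
  subtrees, so the root index \<open>[]\<close>, which lies outside \<open>Theta\<close>, never
  matters.\<close>

lemma mlp_val_cong:
  assumes "\<And>\<eta>. \<eta> \<noteq> [] \<Longrightarrow> w \<eta> = w' \<eta>"
  shows "mlp_val \<Phi> m n w = mlp_val \<Phi> m n w'"
  using assms
proof (induction n arbitrary: w w' rule: less_induct)
  case (less n)
  show ?case
    by (subst (1 2) mlp_val.simps)
      (auto intro!: sum.cong arg_cong[where f = "scaleR _"] arg_cong[where f = "\<Phi> _"] less)
qed

lemma mlp_term_cong:
  assumes "\<And>\<zeta>. \<zeta> \<in> mlp_dom \<Longrightarrow> w \<zeta> = w' \<zeta>"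
  shows "mlp_term \<Phi> m l w = mlp_term \<Phi> m l w'"
proof -
  have "w (a # \<eta>) = w' (a # \<eta>)" if "a = 0 \<or> a = 1" for a \<eta>
    using that by (intro assms) (auto simp: mlp_dom_def)
  then show ?thesis by (simp add: mlp_term_def)
qed

text \<open>For \<open>l > 0\<close> this unfolds the relabelling. For \<open>l = 0\<close> the
  second argument is a level-0 value, hence 0, and the changed sign of \<open>i\<close> cannot be
  seen.\<close>

lemma mlp_term_branch:
  "mlp_term \<Phi> m l (\<lambda>\<zeta>. w (mlp_branch \<theta> l i \<zeta>)) =
    \<Phi> l (mlp_val \<Phi> m l (\<lambda>\<eta>. w (\<theta> @ [int l, int i] @ \<eta>)),
      mlp_val \<Phi> m (l - 1) (\<lambda>\<eta>. w (\<theta> @ [- int l, int i] @ \<eta>)), w (\<theta> @ [int l, int i]))"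
  by (cases "l = 0") (auto simp: mlp_term_def mlp_branch_def)

text \<open>The head of the argument is recovered from a sign: that of \<open>l\<close> if
  \<open>l > 0\<close>, and that of \<open>i\<close> if \<open>l = 0\<close>. The latter needs
  \<open>i \<ge> 1\<close>.\<close>

lemma inj_on_mlp_branch: "i \<ge> 1 \<Longrightarrow> inj_on (mlp_branch \<theta> l i) mlp_dom"
  by (rule inj_onI) (auto simp: mlp_branch_def mlp_dom_def neq_Nil_conv split: if_splits)

lemma measurable_pair3:
  assumes "\<Phi> \<in> measurable (borel \<Otimes>\<^sub>M borel \<Otimes>\<^sub>M Zs) borel"
    and "f \<in> borel_measurable N" "g \<in> borel_measurable N" "h \<in> measurable N Zs"
  shows "(\<lambda>x. \<Phi> (f x, g x, h x)) \<in> borel_measurable N"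
  by (rule measurable_compose[OF _ assms(1)]) (intro measurable_Pair assms(2-))

lemma mlp_val_measurable:
  fixes \<Phi> :: "nat \<Rightarrow> 'y \<times> 'y \<times> 'z \<Rightarrow> 'y::{banach, second_countable_topology}"
  assumes \<Phi>: "\<And>l. \<Phi> l \<in> measurable (borel \<Otimes>\<^sub>M borel \<Otimes>\<^sub>M Zs) borel"
    and X: "\<And>\<eta>. \<eta> \<noteq> [] \<Longrightarrow> X \<eta> \<in> measurable N Zs"
  shows "(\<lambda>x. mlp_val \<Phi> m n (\<lambda>\<eta>. X \<eta> x)) \<in> borel_measurable N"
  using X
proof (induction n arbitrary: X rule: less_induct)
  case (less n)
  show ?case
    by (subst mlp_val.simps)
      (intro borel_measurable_sum borel_measurable_scaleR borel_measurable_const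
        measurable_pair3[OF \<Phi>] less; simp)
qed

lemma mlp_term_measurable:
  fixes \<Phi> :: "nat \<Rightarrow> 'y \<times> 'y \<times> 'z \<Rightarrow> 'y::{banach, second_countable_topology}"
  assumes \<Phi>: "\<And>l. \<Phi> l \<in> measurable (borel \<Otimes>\<^sub>M borel \<Otimes>\<^sub>M Zs) borel"
    and X: "\<And>\<zeta>. \<zeta> \<in> mlp_dom \<Longrightarrow> X \<zeta> \<in> measurable N Zs"
  shows "(\<lambda>x. mlp_term \<Phi> m l (\<lambda>\<zeta>. X \<zeta> x)) \<in> borel_measurable N"
  unfolding mlp_term_def
  by (intro measurable_pair3[OF \<Phi>] mlp_val_measurable[OF \<Phi>] X) (auto simp: mlp_dom_def)

section \<open>The random scheme for one fixed sample base\<close>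

locale mlp_scheme = prob_space P
  for P :: "'w measure" +
  fixes Zs :: "'z measure"
    and Z :: "int list \<Rightarrow> 'w \<Rightarrow> 'z"
    and \<Phi> :: "nat \<Rightarrow> 'y \<times> 'y \<times> 'z \<Rightarrow> 'y::{banach, second_countable_topology}"
    and m :: nat
    and Y :: "int list \<Rightarrow> int \<Rightarrow> 'w \<Rightarrow> 'y"
  assumes m_pos: "m \<ge> 1"
    and Z_measurable: "\<And>\<theta>. \<theta> \<in> Theta \<Longrightarrow> Z \<theta> \<in> measurable P Zs"
    and Z_iid: "iid_family P Theta Zs Z"
    and \<Phi>_measurable: "\<And>l. \<Phi> l \<in> measurable (borel \<Otimes>\<^sub>M borel \<Otimes>\<^sub>M Zs) borel"
    and Y_init: "\<And>\<theta> \<omega>. \<theta> \<in> Theta \<Longrightarrow> \<omega> \<in> space P \<Longrightarrow> Y \<theta> (-1) \<omega> = 0 \<and> Y \<theta> 0 \<omega> = 0"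
    and Y_rec: "\<And>\<theta> n \<omega>. \<theta> \<in> Theta \<Longrightarrow> n \<ge> 1 \<Longrightarrow> \<omega> \<in> space P \<Longrightarrow>
          Y \<theta> (int n) \<omega> =
            (\<Sum>l<n. (1 / real m ^ (n - l)) *\<^sub>R
              (\<Sum>i = 1..m ^ (n - l).
                 \<Phi> l (Y (\<theta> @ [int l, int i]) (int l) \<omega>,
                      Y (\<theta> @ [- int l, int i]) (int l - 1) \<omega>,
                      Z (\<theta> @ [int l, int i]) \<omega>)))"
begin

text \<open>Pathwise strong induction: the recursion determines \<open>Y \<theta>\<close> from the
  noise at the descendants of \<theta>. Measurability, equality in law and independence are all read
  off from this representation.\<close>

lemma Y_eq_mlp_val:
  assumes "\<theta> \<in> Theta" "\<omega> \<in> space P"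
  shows "Y \<theta> (int n) \<omega> = mlp_val \<Phi> m n (\<lambda>\<eta>. Z (\<theta> @ \<eta>) \<omega>)"
  using assms(1)
proof (induction n arbitrary: \<theta> rule: less_induct)
  case (less n)
  show ?case
  proof (cases "n = 0")
    case True
    then show ?thesis using Y_init[OF less.prems assms(2)] by simp
  next
    case False
    \<comment> \<open>At \<open>l = 0\<close> the left side is the prescribed value at level -1 and
      the right side is the level-0 value; both are 0.\<close>
    have "Y \<eta> (int l - 1) \<omega> = mlp_val \<Phi> m (l - 1) (\<lambda>\<zeta>. Z (\<eta> @ \<zeta>) \<omega>)"
      if "l < n" "\<eta> \<in> Theta" for l \<eta>
    proof (cases l)
      case 0
      then show ?thesis using Y_init[OF that(2) assms(2)] by simp
    next
      case (Suc k)
      with less.IH[of k \<eta>] that show ?thesis by simp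
    qed
    with False show ?thesis
      by (subst mlp_val.simps, subst Y_rec[OF less.prems _ assms(2)])
        (auto simp: less.IH Theta_def intro!: sum.cong arg_cong[where f = "scaleR _"])
  qed
qed

lemma Y_pred_eq_mlp_val:
  assumes "\<theta> \<in> Theta" "\<omega> \<in> space P"
  shows "Y \<theta> (int n - 1) \<omega> = mlp_val \<Phi> m (n - 1) (\<lambda>\<eta>. Z (\<theta> @ \<eta>) \<omega>)"
  using Y_eq_mlp_val[OF assms, of "n - 1"] Y_init[OF assms] by (cases n) auto

lemma Y_measurable: "\<theta> \<in> Theta \<Longrightarrow> Y \<theta> (int n) \<in> borel_measurable P"
  by (subst measurable_cong[OF Y_eq_mlp_val])
    (auto intro!: mlp_val_measurable[OF \<Phi>_measurable] Z_measurable simp: Theta_def)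

section \<open>Laws and independence of the summands\<close>

definition level :: "nat \<Rightarrow> 'w \<Rightarrow> 'y"
  where "level l \<omega> = \<Phi> l (Y [0] (int l) \<omega>, Y [1] (int l - 1) \<omega>, Z [0] \<omega>)"

lemma level_eq_mlp_term: "\<omega> \<in> space P \<Longrightarrow> level l \<omega> = mlp_term \<Phi> m l (\<lambda>\<zeta>. Z \<zeta> \<omega>)"
  by (simp add: level_def mlp_term_def Y_eq_mlp_val Y_pred_eq_mlp_val Theta_def)

lemma level_measurable: "level l \<in> borel_measurable P"
  by (subst measurable_cong[OF level_eq_mlp_term])
    (auto intro!: mlp_term_measurable[OF \<Phi>_measurable] Z_measurable simp: Theta_def mlp_dom_def)

text \<open>Independence makes the law of the whole family a product, and equality in law makes all
  factors equal. Such a product is carried to a product of the same kind by any injective change of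
  index.\<close>

lemma distr_family_reindex:
  assumes "J \<noteq> {}" "inj_on r J" "r \<in> J \<rightarrow> Theta"
  shows "distr P (PiM J (\<lambda>_. Zs)) (\<lambda>\<omega>. \<lambda>\<eta>\<in>J. Z (r \<eta>) \<omega>) = PiM J (\<lambda>_. distr P Zs (Z [0]))"
proof -
  let ?\<mu> = "distr P Zs (Z [0])"
  have 0: "[0] \<in> Theta" by (simp add: Theta_def)
  interpret \<mu>: prob_space ?\<mu> by (rule prob_space_distr[OF Z_measurable[OF 0]])
  have W: "(\<lambda>\<omega>. \<lambda>\<theta>\<in>Theta. Z \<theta> \<omega>) \<in> measurable P (PiM Theta (\<lambda>_. Zs))"
    by (intro measurable_restrict Z_measurable)
  have R: "(\<lambda>w. \<lambda>\<eta>\<in>J. w (r \<eta>)) \<in> measurable (PiM Theta (\<lambda>_. Zs)) (PiM J (\<lambda>_. Zs))"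
    using assms(3) by (intro measurable_restrict measurable_component_singleton) auto
  have "distr P (PiM J (\<lambda>_. Zs)) (\<lambda>\<omega>. \<lambda>\<eta>\<in>J. Z (r \<eta>) \<omega>)
      = distr (distr P (PiM Theta (\<lambda>_. Zs)) (\<lambda>\<omega>. \<lambda>\<theta>\<in>Theta. Z \<theta> \<omega>)) (PiM J (\<lambda>_. Zs)) (\<lambda>w. \<lambda>\<eta>\<in>J. w (r \<eta>))"
    unfolding distr_distr[OF R W] comp_def
    using assms(3) by (intro distr_cong refl restrict_ext) (auto simp: Pi_iff)
  also have "distr P (PiM Theta (\<lambda>_. Zs)) (\<lambda>\<omega>. \<lambda>\<theta>\<in>Theta. Z \<theta> \<omega>) = PiM Theta (\<lambda>\<theta>. distr P Zs (Z \<theta>))"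
  proof (rule indep_vars_iff_distr_eq_PiM'[THEN iffD1])
    show "Theta \<noteq> {}" using 0 by blast
    show "indep_vars (\<lambda>_. Zs) Z Theta" using Z_iid by (simp add: iid_family_def)
  qed (rule Z_measurable)
  also have "\<dots> = PiM Theta (\<lambda>_. ?\<mu>)"
  proof (rule PiM_cong)
    fix \<theta> assume "\<theta> \<in> Theta"
    with 0 Z_iid show "distr P Zs (Z \<theta>) = ?\<mu>" unfolding iid_family_def by blast
  qed simp
  \<comment> \<open>A pushforward depends on its target only through the measurable sets, so the
    target may be replaced by the product of the laws, the form required for reindexing product
    measures.\<close>
  also have "distr \<dots> (PiM J (\<lambda>_. Zs)) (\<lambda>w. \<lambda>\<eta>\<in>J. w (r \<eta>))
      = distr \<dots> (PiM J (\<lambda>_. ?\<mu>)) (\<lambda>w. \<lambda>\<eta>\<in>J. w (r \<eta>))"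
    by (intro distr_cong sets_PiM_cong) auto
  also have "\<dots> = PiM J (\<lambda>_. ?\<mu>)"
    using assms by (intro distr_PiM_reindex \<mu>.prob_space_axioms) auto
  finally show ?thesis .
qed

text \<open>Both sides are the image under \<open>f\<close> of the same product measure. This turns
  an injective relabelling of the noise into equality in law of the resulting random
  variables.\<close>

lemma distr_functional_reindex:
  assumes J: "J \<noteq> {}" and r: "inj_on r J" "r \<in> J \<rightarrow> Theta" and r': "inj_on r' J" "r' \<in> J \<rightarrow> Theta"
    and f: "f \<in> measurable (PiM J (\<lambda>_. Zs)) N"
  shows "distr P N (\<lambda>\<omega>. f (\<lambda>\<eta>\<in>J. Z (r \<eta>) \<omega>)) = distr P N (\<lambda>\<omega>. f (\<lambda>\<eta>\<in>J. Z (r' \<eta>) \<omega>))"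
proof -
  have "distr P N (\<lambda>\<omega>. f (\<lambda>\<eta>\<in>J. Z (s \<eta>) \<omega>)) = distr (PiM J (\<lambda>_. distr P Zs (Z [0]))) N f"
    if s: "inj_on s J" "s \<in> J \<rightarrow> Theta" for s
  proof -
    have "(\<lambda>\<omega>. \<lambda>\<eta>\<in>J. Z (s \<eta>) \<omega>) \<in> measurable P (PiM J (\<lambda>_. Zs))"
      using s by (intro measurable_restrict Z_measurable) auto
    then show ?thesis
      unfolding distr_family_reindex[OF J s, symmetric] by (subst distr_distr[OF f]) (auto simp: comp_def)
  qed
  from this[OF r] this[OF r'] show ?thesis by simp
qed

lemma distr_mlp_term_branch:
  assumes "\<theta> \<in> Theta" "i \<ge> 1"
  shows "distr P borel (\<lambda>\<omega>. mlp_term \<Phi> m l (\<lambda>\<zeta>. Z (mlp_branch \<theta> l i \<zeta>) \<omega>)) = distr P borel (level l)"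
proof -
  have f: "(\<lambda>w. mlp_term \<Phi> m l w) \<in> measurable (PiM mlp_dom (\<lambda>_. Zs)) borel"
    using mlp_term_measurable[OF \<Phi>_measurable, of "\<lambda>\<zeta> w. w \<zeta>"] by simp
  \<comment> \<open>The noise is restricted to \<open>mlp_dom\<close> first, because the relabelling
    is injective only there. The functional does not read anything outside.\<close>
  have "distr P borel (\<lambda>\<omega>. mlp_term \<Phi> m l (\<lambda>\<zeta>\<in>mlp_dom. Z (mlp_branch \<theta> l i \<zeta>) \<omega>))
      = distr P borel (\<lambda>\<omega>. mlp_term \<Phi> m l (\<lambda>\<zeta>\<in>mlp_dom. Z \<zeta> \<omega>))"
    using assms
    by (intro distr_functional_reindex inj_on_mlp_branch f)
      (auto simp: mlp_branch_def Theta_def mlp_dom_def)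
  also have "(\<lambda>\<omega>. mlp_term \<Phi> m l (\<lambda>\<zeta>\<in>mlp_dom. Z (mlp_branch \<theta> l i \<zeta>) \<omega>))
      = (\<lambda>\<omega>. mlp_term \<Phi> m l (\<lambda>\<zeta>. Z (mlp_branch \<theta> l i \<zeta>) \<omega>))"
    by (intro ext mlp_term_cong) simp
  also have "(\<lambda>\<omega>. mlp_term \<Phi> m l (\<lambda>\<zeta>\<in>mlp_dom. Z \<zeta> \<omega>)) = (\<lambda>\<omega>. mlp_term \<Phi> m l (\<lambda>\<zeta>. Z \<zeta> \<omega>))"
    by (intro ext mlp_term_cong) simp
  also have "distr P borel (\<lambda>\<omega>. mlp_term \<Phi> m l (\<lambda>\<zeta>. Z \<zeta> \<omega>)) = distr P borel (level l)"
    by (intro distr_cong) (simp_all add: level_eq_mlp_term)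
  finally show ?thesis .
qed

lemma distr_Y:
  assumes "\<theta> \<in> Theta"
  shows "distr P borel (Y \<theta> (int n)) = distr P borel (Y [0] (int n))"
proof -
  have f: "(\<lambda>w. mlp_val \<Phi> m n w) \<in> measurable (PiM Theta (\<lambda>_. Zs)) borel"
    using mlp_val_measurable[OF \<Phi>_measurable, of "\<lambda>\<zeta> w. w \<zeta>"] by (simp add: Theta_def)
  have eq: "distr P borel (Y \<eta> (int n)) = distr P borel (\<lambda>\<omega>. mlp_val \<Phi> m n (\<lambda>\<zeta>\<in>Theta. Z (\<eta> @ \<zeta>) \<omega>))"
    if "\<eta> \<in> Theta" for \<eta>
    using that by (intro distr_cong) (auto simp: Y_eq_mlp_val Theta_def intro!: mlp_val_cong)
  have "distr P borel (\<lambda>\<omega>. mlp_val \<Phi> m n (\<lambda>\<zeta>\<in>Theta. Z (\<theta> @ \<zeta>) \<omega>))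
      = distr P borel (\<lambda>\<omega>. mlp_val \<Phi> m n (\<lambda>\<zeta>\<in>Theta. Z ([0] @ \<zeta>) \<omega>))"
    using assms by (intro distr_functional_reindex f) (auto simp: Theta_def intro!: inj_onI)
  with eq[OF assms] eq[of "[0]"] show ?thesis by (simp add: Theta_def)
qed

text \<open>Different pairs (l, i) read disjoint blocks of the independent noise family, and each
  summand is a measurable function of its block.\<close>

lemma indep_vars_mlp_terms:
  assumes \<theta>: "\<theta> \<in> Theta"
  shows "indep_vars (\<lambda>_. borel)
    (\<lambda>p \<omega>. mlp_term \<Phi> m (fst p) (\<lambda>\<zeta>. Z (mlp_branch \<theta> (fst p) (snd p) \<zeta>) \<omega>)) I"
proof -
  \<comment> \<open>Absolute values collect the indices with signs l and -l, or i and -i, into one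
    block, so that it contains both subtrees of a summand.\<close>
  define K where "K p = {\<theta> @ [a, b] @ \<eta> | a b \<eta>. \<bar>a\<bar> = int (fst p) \<and> \<bar>b\<bar> = int (snd p)}"
    for p :: "nat \<times> nat"
  have K: "mlp_branch \<theta> (fst p) (snd p) \<zeta> \<in> K p" for p \<zeta>
    unfolding K_def mlp_branch_def by force
  have "indep_vars (\<lambda>p. PiM (K p) (\<lambda>_. Zs)) (\<lambda>p \<omega>. restrict (\<lambda>\<zeta>. Z \<zeta> \<omega>) (K p)) I"
  proof (rule indep_vars_restrict)
    show "indep_vars (\<lambda>_. Zs) Z Theta"
      using Z_iid by (simp add: iid_family_def)
    show "disjoint_family_on K I"
      unfolding disjoint_family_on_def
    proof (intro ballI impI)
      fix p q :: "nat \<times> nat"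
      assume "p \<noteq> q"
      then show "K p \<inter> K q = {}"
        by (cases p; cases q) (auto simp: K_def)
    qed
  qed (auto simp: K_def Theta_def)
  then have "indep_vars (\<lambda>_. borel) (\<lambda>p \<omega>. mlp_term \<Phi> m (fst p)
      (\<lambda>\<zeta>. restrict (\<lambda>\<zeta>. Z \<zeta> \<omega>) (K p) (mlp_branch \<theta> (fst p) (snd p) \<zeta>))) I"
    by (rule indep_vars_compose2)
      (intro mlp_term_measurable[OF \<Phi>_measurable] measurable_component_singleton K)
  then show ?thesis by (simp add: K)
qed

text \<open>The two approximations inside a summand read only indices of length at least two, hence
  are jointly independent of \<open>Z [0]\<close>. Integrating \<open>Z [0]\<close> separately
  allows hypotheses on \<Phi> with fixed arguments \<open>u\<close> and \<open>v\<close> to be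
  applied.\<close>

lemma nn_integral_level:
  assumes f: "f \<in> borel_measurable borel"
  shows "(\<integral>\<^sup>+ \<omega>. f (level l \<omega>) \<partial>P)
    = (\<integral>\<^sup>+ \<omega>. \<integral>\<^sup>+ \<omega>'. f (\<Phi> l (Y [0] (int l) \<omega>, Y [1] (int l - 1) \<omega>, Z [0] \<omega>')) \<partial>P \<partial>P)"
proof -
  define A :: "int list set" where "A = {\<zeta>. length \<zeta> \<ge> 2}"
  let ?MA = "PiM A (\<lambda>_. Zs)" and ?MB = "PiM {[0]} (\<lambda>_. Zs)"
  let ?WA = "\<lambda>\<omega>. \<lambda>\<zeta>\<in>A. Z \<zeta> \<omega>" and ?WB = "\<lambda>\<omega>. \<lambda>\<zeta>\<in>{[0]}. Z \<zeta> \<omega>"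
  let ?U = "\<lambda>w. mlp_val \<Phi> m l (\<lambda>\<eta>. w (0 # \<eta>))" and ?V = "\<lambda>w. mlp_val \<Phi> m (l - 1) (\<lambda>\<eta>. w (1 # \<eta>))"
  let ?g = "\<lambda>p. f (\<Phi> l (?U (fst p), ?V (fst p), snd p [0]))"
  have A: "a # \<eta> \<in> A" if "\<eta> \<noteq> []" for a \<eta>
    using that by (cases \<eta>) (auto simp: A_def)
  have ind: "indep_var ?MA ?WA ?MB ?WB"
    using Z_iid
    by (intro indep_var_restrict[where I = Theta]) (auto simp: iid_family_def A_def Theta_def)
  have WA: "?WA \<in> measurable P ?MA"
    by (intro measurable_restrict Z_measurable) (auto simp: A_def Theta_def)
  have WB: "?WB \<in> measurable P ?MB"
    by (intro measurable_restrict Z_measurable) (auto simp: Theta_def)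
  have wA: "(\<lambda>p. fst p \<zeta>) \<in> measurable (?MA \<Otimes>\<^sub>M ?MB) Zs" if "\<zeta> \<in> A" for \<zeta>
    by (rule measurable_compose[OF measurable_fst measurable_component_singleton[OF that]])
  have wB: "(\<lambda>p. snd p [0]) \<in> measurable (?MA \<Otimes>\<^sub>M ?MB) Zs"
    by (rule measurable_compose[OF measurable_snd measurable_component_singleton]) simp
  have g: "?g \<in> borel_measurable (?MA \<Otimes>\<^sub>M ?MB)"
    by (intro measurable_compose[OF measurable_pair3[OF \<Phi>_measurable] f]
      mlp_val_measurable[OF \<Phi>_measurable] wA wB A)
  have U: "?U (?WA \<omega>) = Y [0] (int l) \<omega>" and V: "?V (?WA \<omega>) = Y [1] (int l - 1) \<omega>"
    if "\<omega> \<in> space P" for \<omega>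
    using that A by (auto simp: Y_eq_mlp_val Y_pred_eq_mlp_val Theta_def intro!: mlp_val_cong)
  interpret B: prob_space "distr P ?MB ?WB"
    by (rule prob_space_distr[OF WB])
  have "(\<integral>\<^sup>+ \<omega>. f (level l \<omega>) \<partial>P) = (\<integral>\<^sup>+ \<omega>. ?g (?WA \<omega>, ?WB \<omega>) \<partial>P)"
    by (intro nn_integral_cong) (simp only: fst_conv snd_conv U V, simp add: level_def)
  also have "\<dots> = (\<integral>\<^sup>+ p. ?g p \<partial>distr P (?MA \<Otimes>\<^sub>M ?MB) (\<lambda>\<omega>. (?WA \<omega>, ?WB \<omega>)))"
    by (rule nn_integral_distr'[symmetric, OF measurable_Pair[OF WA WB] g])
  also have "distr P (?MA \<Otimes>\<^sub>M ?MB) (\<lambda>\<omega>. (?WA \<omega>, ?WB \<omega>)) = distr P ?MA ?WA \<Otimes>\<^sub>M distr P ?MB ?WB"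
    using ind by (simp only: indep_var_distribution_eq)
  also have "(\<integral>\<^sup>+ p. ?g p \<partial>\<dots>) = (\<integral>\<^sup>+ w. \<integral>\<^sup>+ v. ?g (w, v) \<partial>distr P ?MB ?WB \<partial>distr P ?MA ?WA)"
    using g by (intro B.nn_integral_fst[symmetric])
      (simp add: measurable_cong_sets[OF sets_pair_measure_cong[OF sets_distr sets_distr] refl])
  also have "\<dots> = (\<integral>\<^sup>+ \<omega>. \<integral>\<^sup>+ v. ?g (?WA \<omega>, v) \<partial>distr P ?MB ?WB \<partial>P)"
    using g by (intro nn_integral_distr'[OF WA] B.borel_measurable_nn_integral_fst)
      (simp add: measurable_cong_sets[OF sets_pair_measure_cong[OF refl sets_distr] refl])
  also have "\<dots> = (\<integral>\<^sup>+ \<omega>. \<integral>\<^sup>+ \<omega>'. ?g (?WA \<omega>, ?WB \<omega>') \<partial>P \<partial>P)"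
    using measurable_space[OF WA]
    by (intro nn_integral_cong nn_integral_distr'[OF WB] measurable_Pair2[OF g]) auto
  also have "\<dots> = (\<integral>\<^sup>+ \<omega>. \<integral>\<^sup>+ \<omega>'. f (\<Phi> l (Y [0] (int l) \<omega>, Y [1] (int l - 1) \<omega>, Z [0] \<omega>')) \<partial>P \<partial>P)"
    by (intro nn_integral_cong) (simp only: fst_conv snd_conv U V, simp)
  finally show ?thesis .
qed

text \<open>The scheme is a weighted sum of independent summands whose total mean is the sum of the
  level means; this gives the bias term. At level \<open>l\<close> there are
  \<open>m ^ (n - l)\<close> variance terms, each with the squared weight, and together they
  contribute the weight once.\<close>

lemma mean_sq_Y_le:
  fixes \<nu> :: "('y \<Rightarrow>\<^sub>L 'h::{real_inner, banach, second_countable_topology}) measure"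
  assumes \<nu>: "sigma_finite_measure \<nu>" "sets \<nu> = sets strong_algebra"
    and int: "\<And>l. integrable P (level l)" and "n \<ge> 1"
  shows "(\<integral>\<^sup>+ \<omega>. mean_sq \<nu> (Y [0] (int n) \<omega> - y) \<partial>P)
    \<le> mean_sq \<nu> (y - (\<Sum>l<n. \<integral>\<omega>. level l \<omega> \<partial>P))
      + (\<Sum>l<n. ennreal (1 / real m ^ (n - l)) * (\<integral>\<^sup>+ \<omega>. mean_sq \<nu> (level l \<omega>) \<partial>P))"
proof -
  define I where "I = Sigma {..<n} (\<lambda>l. {1..m ^ (n - l)})"
  define s :: "nat \<times> nat \<Rightarrow> real" where "s p = 1 / real m ^ (n - fst p)" for p
  define X where "X p = (\<lambda>\<omega>. mlp_term \<Phi> m (fst p) (\<lambda>\<zeta>. Z (mlp_branch [0] (fst p) (snd p) \<zeta>) \<omega>))" for p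
  define D where "D p = distr P borel (level (fst p))" for p :: "nat \<times> nat"
  have 0: "[0] \<in> Theta" by (simp add: Theta_def)
  have "finite I" by (simp add: I_def)
  \<comment> \<open>Nonemptiness of the index set is required when independence is expressed through
    the product law.\<close>
  have "(0, 1) \<in> I" using m_pos \<open>n \<ge> 1\<close> by (simp add: I_def)
  then have "I \<noteq> {}" by blast
  have sum_I: "(\<Sum>p\<in>I. h (fst p) (snd p)) = (\<Sum>l<n. \<Sum>i = 1..m ^ (n - l). h l i)"
    for h :: "nat \<Rightarrow> nat \<Rightarrow> 'b::comm_monoid_add"
    unfolding I_def by (subst sum.Sigma) (auto simp: case_prod_beta)
  have X: "X p \<in> borel_measurable P" for p
    unfolding X_def by (intro mlp_term_measurable[OF \<Phi>_measurable] Z_measurable)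
      (simp add: mlp_branch_def Theta_def)
  have Y: "Y [0] (int n) \<omega> = (\<Sum>p\<in>I. s p *\<^sub>R X p \<omega>)" if "\<omega> \<in> space P" for \<omega>
    unfolding s_def X_def sum_I[of "\<lambda>l i. (1 / real m ^ (n - l)) *\<^sub>R
        mlp_term \<Phi> m l (\<lambda>\<zeta>. Z (mlp_branch [0] l i \<zeta>) \<omega>)"]
    by (subst Y_eq_mlp_val[OF 0 that], subst mlp_val.simps)
      (simp only: mlp_term_branch[where w = "\<lambda>\<zeta>. Z \<zeta> \<omega>"] scaleR_right.sum append_assoc)
  have D: "prob_space (D p)" "sets (D p) = sets borel" "integrable (D p) (\<lambda>x. x)" for p
    using int[of "fst p"] level_measurable
    by (auto simp: D_def integrable_distr_eq intro: prob_space_distr)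
  have law: "distr P (PiM I (\<lambda>_. borel)) (\<lambda>\<omega>. \<lambda>p\<in>I. X p \<omega>) = PiM I D"
  proof -
    have "distr P (PiM I (\<lambda>_. borel)) (\<lambda>\<omega>. \<lambda>p\<in>I. X p \<omega>) = PiM I (\<lambda>p. distr P borel (X p))"
      using indep_vars_mlp_terms[OF 0, of I]
      by (intro indep_vars_iff_distr_eq_PiM'[THEN iffD1] \<open>I \<noteq> {}\<close> X) (simp add: X_def)
    also have "\<dots> = PiM I D"
      by (intro PiM_cong) (auto simp: X_def D_def I_def intro!: distr_mlp_term_branch[OF 0])
    finally show ?thesis .
  qed
  have meas: "(\<lambda>w. mean_sq \<nu> (- y + (\<Sum>p\<in>I. s p *\<^sub>R w p))) \<in> borel_measurable (PiM I (\<lambda>_. borel))"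
    by (intro mean_sq_measurable[OF \<nu>] borel_measurable_add borel_measurable_const
      borel_measurable_sum borel_measurable_scaleR measurable_component_singleton)
  have W: "(\<lambda>\<omega>. \<lambda>p\<in>I. X p \<omega>) \<in> measurable P (PiM I (\<lambda>_. borel))"
    by (intro measurable_restrict X)
  have "(\<integral>\<^sup>+ \<omega>. mean_sq \<nu> (Y [0] (int n) \<omega> - y) \<partial>P)
      = (\<integral>\<^sup>+ \<omega>. mean_sq \<nu> (- y + (\<Sum>p\<in>I. s p *\<^sub>R (\<lambda>p\<in>I. X p \<omega>) p)) \<partial>P)"
    by (intro nn_integral_cong) (simp add: Y)
  also have "\<dots> = (\<integral>\<^sup>+ w. mean_sq \<nu> (- y + (\<Sum>p\<in>I. s p *\<^sub>R w p)) \<partial>PiM I D)"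
    unfolding law[symmetric] by (rule nn_integral_distr'[symmetric, OF W meas])
  also have "\<dots> \<le> mean_sq \<nu> (- y + (\<Sum>p\<in>I. s p *\<^sub>R (\<integral>x. x \<partial>D p)))
      + (\<Sum>p\<in>I. ennreal ((s p)\<^sup>2) * (\<integral>\<^sup>+ x. mean_sq \<nu> x \<partial>D p))"
    by (rule mean_sq_PiM_sum_le[OF \<nu> D \<open>finite I\<close>])
  also have "(\<Sum>p\<in>I. s p *\<^sub>R (\<integral>x. x \<partial>D p)) = (\<Sum>l<n. \<integral>\<omega>. level l \<omega> \<partial>P)"
    unfolding s_def D_def sum_I[of "\<lambda>l i. (1 / real m ^ (n - l)) *\<^sub>R (\<integral>x. x \<partial>distr P borel (level l))"]
    using m_pos by (intro sum.cong refl) (simp add: integral_distr[OF level_measurable] sum_constant_scaleR)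
  also have "mean_sq \<nu> (- y + \<dots>) = mean_sq \<nu> (y - \<dots>)"
    using mean_sq_minus_commute[of \<nu> _ y] by simp
  also have "(\<Sum>p\<in>I. ennreal ((s p)\<^sup>2) * (\<integral>\<^sup>+ x. mean_sq \<nu> x \<partial>D p))
      = (\<Sum>l<n. ennreal (1 / real m ^ (n - l)) * (\<integral>\<^sup>+ \<omega>. mean_sq \<nu> (level l \<omega>) \<partial>P))"
  proof -
    \<comment> \<open>Here \<open>k\<close> is the number of equal summands: \<open>k\<close> copies
      of the squared weight add up to 1/k.\<close>
    have c: "of_nat k * ennreal ((1 / real k)\<^sup>2) = ennreal (1 / real k)" for k
      by (simp add: ennreal_of_nat_eq_real_of_nat ennreal_mult[symmetric] power2_eq_square)
    have nl: "(\<integral>\<^sup>+ x. mean_sq \<nu> x \<partial>distr P borel (level l)) = (\<integral>\<^sup>+ \<omega>. mean_sq \<nu> (level l \<omega>) \<partial>P)" for l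
      by (rule nn_integral_distr'[OF level_measurable]) (rule mean_sq_measurable[OF \<nu>], simp)
    from c[of "m ^ _"]
    have card: "of_nat (m ^ k) * ennreal ((1 / real m ^ k)\<^sup>2) = ennreal (1 / real m ^ k)" for k
      by simp
    show ?thesis
      unfolding s_def D_def sum_I[of "\<lambda>l i. ennreal ((1 / real m ^ (n - l))\<^sup>2)
          * (\<integral>\<^sup>+ x. mean_sq \<nu> x \<partial>distr P borel (level l))"]
      by (intro sum.cong refl)
        (simp only: sum_constant card_atLeastAtMost diff_Suc_1 mult.assoc[symmetric] card nl)
  qed
  finally show ?thesis by simp
qed

lemma nn_integral_mean_sq_Y_1:
  fixes \<nu> :: "('y \<Rightarrow>\<^sub>L 'h::{real_inner, banach, second_countable_topology}) measure"
  assumes \<nu>: "sigma_finite_measure \<nu>" "sets \<nu> = sets strong_algebra" and "l \<ge> 1"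
  shows "(\<integral>\<^sup>+ \<omega>. mean_sq \<nu> (Y [1] (int l - 1) \<omega> - y) \<partial>P)
    = (\<integral>\<^sup>+ \<omega>. mean_sq \<nu> (Y [0] (int (l - 1)) \<omega> - y) \<partial>P)"
proof -
  have th: "[1] \<in> Theta" "[0] \<in> Theta" by (simp_all add: Theta_def)
  have q: "(\<lambda>x. mean_sq \<nu> (x - y)) \<in> borel_measurable borel"
    by (intro mean_sq_measurable[OF \<nu>]) simp
  have "(\<integral>\<^sup>+ \<omega>. mean_sq \<nu> (Y [1] (int (l - 1)) \<omega> - y) \<partial>P)
      = (\<integral>\<^sup>+ \<omega>. mean_sq \<nu> (Y [0] (int (l - 1)) \<omega> - y) \<partial>P)"
    using nn_integral_distr'[OF Y_measurable[OF th(1)] q] nn_integral_distr'[OF Y_measurable[OF th(2)] q]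
    by (simp add: distr_Y[OF th(1)])
  moreover have "int l - 1 = int (l - 1)" using \<open>l \<ge> 1\<close> by (simp add: of_nat_diff)
  ultimately show ?thesis by (simp only:)
qed

end

section \<open>The error recursion\<close>

text \<open>Closed form, for nonzero \<open>x\<close>, of the shifted exponential series with terms
  x^i / (k + i)!. The finite sum makes its one-step recurrence a matter of algebra.\<close>

definition exp_tail :: "real \<Rightarrow> nat \<Rightarrow> real"
  where "exp_tail x k = (exp x - (\<Sum>i<k. x ^ i / fact i)) / x ^ k"

lemma exp_tail_0 [simp]: "exp_tail x 0 = exp x"
  by (simp add: exp_tail_def)

lemma exp_tail_Suc: "x > 0 \<Longrightarrow> x * exp_tail x (Suc k) = exp_tail x k - 1 / fact k"
  by (simp add: exp_tail_def field_simps)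

lemma exp_tail_nonneg:
  assumes "x > 0"
  shows "exp_tail x k \<ge> 0"
proof -
  have "(\<Sum>i<k. x ^ i / fact i) \<le> exp x"
    unfolding exp_def using assms summable_exp_generic[of x]
    by (subst sum.cong[OF refl, of _ _ "\<lambda>i. x ^ i /\<^sub>R fact i"])
      (auto simp: field_simps intro!: sum_le_suminf)
  then show ?thesis using assms by (simp add: exp_tail_def)
qed

text \<open>The left side is the first term of the shifted series; the recurrence leaves a
  nonnegative remainder.\<close>

lemma exp_tail_ge:
  assumes "x > 0"
  shows "1 / fact k \<le> exp_tail x k"
  using exp_tail_Suc[OF assms, of k] exp_tail_nonneg[OF assms, of "Suc k"] assms
  by (smt (verit) mult_nonneg_nonneg)

text \<open>The factor 7 is chosen so that the bias contribution 8^(n - 1) can be added to give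
  8^n.\<close>

lemma sum_powers_8_le: "n \<ge> 1 \<Longrightarrow> (\<Sum>l=1..<n. 2 * (8 ^ l + 8 ^ (l - 1))) \<le> 7 * (8::real) ^ (n - 1)"
proof (induction n rule: nat_induct_at_least)
  case (Suc n)
  then obtain k where k: "n = Suc k" by (cases n) auto
  have "(\<Sum>l=1..<Suc n. 2 * (8 ^ l + 8 ^ (l - 1))) = (\<Sum>l=1..<n. 2 * (8 ^ l + 8 ^ (l - 1)))
      + 2 * (8 ^ n + (8::real) ^ (n - 1))"
    using Suc.hyps by (rule sum.atLeastLessThan_Suc)
  also have "\<dots> \<le> 7 * 8 ^ (n - 1) + 2 * (8 ^ n + (8::real) ^ (n - 1))"
    by (rule add_right_mono[OF Suc.IH])
  also have "\<dots> \<le> 7 * 8 ^ (Suc n - 1)"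
    by (simp add: k)
  finally show ?case .
qed simp

text \<open>The bound reproduces itself along the recursion because of
  \<open>x * exp_tail x (Suc k) + 1 / fact k = exp_tail x k\<close>.\<close>

lemma mlp_recursion_bound_real:
  fixes c C x :: real
  assumes "c \<ge> 1" "x \<ge> 1" "n \<ge> 1"
  defines "b \<equiv> \<lambda>k n. C\<^sup>2 * (8 * c / x) ^ n * exp_tail x k"
  shows "c * b (Suc k) (n - 1) + 1 / x ^ n * (C\<^sup>2 / fact k)
    + (\<Sum>l=1..<n. 1 / x ^ (n - l) * (c * (2 * b (Suc k) l + 2 * b (Suc k) (l - 1)))) \<le> b k n"
proof -
  define \<tau> where "\<tau> = exp_tail x (Suc k)"
  have x: "x > 0" and "\<tau> \<ge> 0" using assms exp_tail_nonneg[of x] by (auto simp: \<tau>_def)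
  define A where "A = C\<^sup>2 * (x * \<tau>) / x ^ n * c ^ n"
  have "A \<ge> 0" using x \<open>\<tau> \<ge> 0\<close> \<open>c \<ge> 1\<close> by (simp add: A_def)
  have first: "c * b (Suc k) (n - 1) = A * 8 ^ (n - 1)"
  proof -
    obtain j where "n = Suc j" using \<open>n \<ge> 1\<close> by (cases n) auto
    then show ?thesis using x
      by (simp add: b_def A_def \<tau>_def power_divide power_mult_distrib field_simps)
  qed
  have term_le: "1 / x ^ (n - l) * (c * (2 * b (Suc k) l + 2 * b (Suc k) (l - 1)))
      \<le> A * (2 * (8 ^ l + 8 ^ (l - 1)))" if l: "l \<in> {1..<n}" for l
  proof -
    obtain j where j: "l = Suc j" using l by (cases l) auto
    obtain i where i: "n = l + Suc i" using l less_iff_Suc_add[of l n] by auto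
    have cl: "c ^ Suc l \<le> c ^ n" "c ^ l \<le> c ^ n"
      using \<open>c \<ge> 1\<close> l by (auto intro!: power_increasing simp del: power_Suc)
    have "1 / x ^ (n - l) * (c * (2 * b (Suc k) l + 2 * b (Suc k) (l - 1)))
        = 2 * (C\<^sup>2 * \<tau> / x ^ n) * (c ^ Suc l * 8 ^ l + x * (c ^ l * 8 ^ (l - 1)))"
      using x unfolding b_def \<tau>_def[symmetric] j i
      by (simp add: power_divide power_mult_distrib power_add field_simps)
    \<comment> \<open>The second summand carries a factor \<open>x\<close> from its level
      \<open>l - 1\<close>; the first receives one from \<open>x \<ge> 1\<close>. The extra power of
      \<open>c\<close> is covered by \<open>l < n\<close>.\<close>
    also have "\<dots> \<le> 2 * (C\<^sup>2 * \<tau> / x ^ n) * (x * (c ^ n * 8 ^ l) + x * (c ^ n * 8 ^ (l - 1)))"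
    proof (intro mult_left_mono add_mono)
      have "1 * (c ^ Suc l * 8 ^ l) \<le> x * (c ^ n * 8 ^ l)"
        using cl \<open>x \<ge> 1\<close> \<open>c \<ge> 1\<close> by (intro mult_mono) auto
      then show "c ^ Suc l * 8 ^ l \<le> x * (c ^ n * 8 ^ l)" by simp
      show "c ^ l * 8 ^ (l - 1) \<le> c ^ n * 8 ^ (l - 1)"
        using cl by simp
    qed (use x \<open>\<tau> \<ge> 0\<close> in auto)
    also have "\<dots> = A * (2 * (8 ^ l + 8 ^ (l - 1)))"
      by (simp add: A_def field_simps)
    finally show ?thesis .
  qed
  have "c * b (Suc k) (n - 1) + 1 / x ^ n * (C\<^sup>2 / fact k)
      + (\<Sum>l=1..<n. 1 / x ^ (n - l) * (c * (2 * b (Suc k) l + 2 * b (Suc k) (l - 1))))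
    \<le> A * 8 ^ (n - 1) + C\<^sup>2 / x ^ n * (1 / fact k) + A * (7 * 8 ^ (n - 1))"
  proof (intro add_mono)
    have "(\<Sum>l=1..<n. 1 / x ^ (n - l) * (c * (2 * b (Suc k) l + 2 * b (Suc k) (l - 1))))
        \<le> A * (\<Sum>l=1..<n. 2 * (8 ^ l + 8 ^ (l - 1)))"
      unfolding sum_distrib_left[of A] by (intro sum_mono term_le)
    also have "\<dots> \<le> A * (7 * 8 ^ (n - 1))"
      using sum_powers_8_le[OF \<open>n \<ge> 1\<close>] \<open>A \<ge> 0\<close> by (rule mult_left_mono)
    finally show "(\<Sum>l=1..<n. 1 / x ^ (n - l) * (c * (2 * b (Suc k) l + 2 * b (Suc k) (l - 1))))
        \<le> A * (7 * 8 ^ (n - 1))" .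
  qed (simp_all add: first[simplified])
  also have "\<dots> = A * 8 ^ n + C\<^sup>2 / x ^ n * (1 / fact k)"
    using \<open>n \<ge> 1\<close> by (cases n) auto
  \<comment> \<open>The factorial term is enlarged by (8c)^n \<ge> 1, so that both terms share a
    prefactor and the recurrence of \<open>exp_tail\<close> merges them.\<close>
  also have "\<dots> \<le> C\<^sup>2 / x ^ n * (8 * c) ^ n * (x * \<tau>) + C\<^sup>2 / x ^ n * (8 * c) ^ n * (1 / fact k)"
  proof (rule add_mono)
    have "C\<^sup>2 / x ^ n * 1 * (1 / fact k) \<le> C\<^sup>2 / x ^ n * (8 * c) ^ n * (1 / fact k)"
      using \<open>c \<ge> 1\<close> x by (intro mult_right_mono mult_left_mono one_le_power) auto
    then show "C\<^sup>2 / x ^ n * (1 / fact k) \<le> C\<^sup>2 / x ^ n * (8 * c) ^ n * (1 / fact k)" by simp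
  qed (simp add: A_def power_mult_distrib mult_ac)
  also have "\<dots> = C\<^sup>2 / x ^ n * (8 * c) ^ n * exp_tail x k"
  proof -
    have "exp_tail x k = x * \<tau> + 1 / fact k"
      using exp_tail_Suc[OF x, of k] by (simp add: \<tau>_def)
    then show ?thesis by (simp only: distrib_left)
  qed
  also have "\<dots> = b k n"
    by (simp add: b_def power_divide)
  finally show ?thesis .
qed

text \<open>Strong induction on \<open>n\<close> for all \<open>k\<close> at once, since the
  recursion passes from \<open>k\<close> to \<open>Suc k\<close>. The induction hypothesis supplies
  finite bounds, which reduces the extended-real recursion to the real inequality.\<close>

lemma mlp_recursion_bound:
  fixes e :: "nat \<Rightarrow> nat \<Rightarrow> ennreal" and c C x :: real
  assumes "c \<ge> 1" "x \<ge> 1"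
    and e_0: "\<And>k. e k 0 \<le> ennreal (C\<^sup>2 / fact k)"
    and e_rec: "\<And>k n. n \<ge> 1 \<Longrightarrow> e k n \<le> ennreal c * e (Suc k) (n - 1)
      + ennreal (1 / x ^ n) * ennreal (C\<^sup>2 / fact k)
      + (\<Sum>l=1..<n. ennreal (1 / x ^ (n - l)) * (ennreal c * (2 * e (Suc k) l + 2 * e (Suc k) (l - 1))))"
  shows "e k n \<le> ennreal (C\<^sup>2 * (8 * c / x) ^ n * exp_tail x k)"
proof (induction n arbitrary: k rule: less_induct)
  case (less n)
  define b where "b k n = C\<^sup>2 * (8 * c / x) ^ n * exp_tail x k" for k n
  have b: "b k n \<ge> 0" for k n
    using assms(1,2) exp_tail_nonneg[of x k] by (simp add: b_def)
  show ?case
  proof (cases "n = 0")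
    case True
    have "C\<^sup>2 / fact k \<le> b k 0"
      using exp_tail_ge[of x k] \<open>x \<ge> 1\<close> mult_left_mono[of "1 / fact k" "exp_tail x k" "C\<^sup>2"]
      by (simp add: b_def)
    with e_0[of k] True show ?thesis
      unfolding b_def[symmetric] by (auto intro: order_trans ennreal_leI)
  next
    case False
    then have "n \<ge> 1" by simp
    have IH: "e k l \<le> ennreal (b k l)" if "l < n" for k l
      unfolding b_def by (rule less.IH[OF that])
    have "e k n \<le> ennreal c * e (Suc k) (n - 1)
      + ennreal (1 / x ^ n) * ennreal (C\<^sup>2 / fact k)
      + (\<Sum>l=1..<n. ennreal (1 / x ^ (n - l)) * (ennreal c * (2 * e (Suc k) l + 2 * e (Suc k) (l - 1))))"
      by (rule e_rec[OF \<open>n \<ge> 1\<close>])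
    also have "\<dots> \<le> ennreal c * ennreal (b (Suc k) (n - 1))
      + ennreal (1 / x ^ n) * ennreal (C\<^sup>2 / fact k)
      + (\<Sum>l=1..<n. ennreal (1 / x ^ (n - l))
          * (ennreal c * (2 * ennreal (b (Suc k) l) + 2 * ennreal (b (Suc k) (l - 1)))))"
      using False by (intro add_mono mult_left_mono sum_mono IH) auto
    also have "\<dots> = ennreal (c * b (Suc k) (n - 1) + 1 / x ^ n * (C\<^sup>2 / fact k)
      + (\<Sum>l=1..<n. 1 / x ^ (n - l) * (c * (2 * b (Suc k) l + 2 * b (Suc k) (l - 1)))))"
    proof -
      have mult: "ennreal s * ennreal t = ennreal (s * t)" if "s \<ge> 0" for s t
        by (rule ennreal_mult'[OF that, symmetric])
      have two: "2 * ennreal (b k l) + 2 * ennreal (b i j) = ennreal (2 * b k l + 2 * b i j)" for k l i j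
        using b by (simp add: ennreal_plus ennreal_mult)
      have nn: "c \<ge> 0" "1 / x ^ l \<ge> 0" for l using assms(1,2) by simp_all
      have summand: "ennreal (1 / x ^ (n - l))
          * (ennreal c * (2 * ennreal (b (Suc k) l) + 2 * ennreal (b (Suc k) (l - 1))))
          = ennreal (1 / x ^ (n - l) * (c * (2 * b (Suc k) l + 2 * b (Suc k) (l - 1))))" for l
        by (simp only: two mult nn)
      have sum: "(\<Sum>l=1..<n. ennreal (1 / x ^ (n - l) * (c * (2 * b (Suc k) l + 2 * b (Suc k) (l - 1)))))
          = ennreal (\<Sum>l=1..<n. 1 / x ^ (n - l) * (c * (2 * b (Suc k) l + 2 * b (Suc k) (l - 1))))"
        by (intro sum_ennreal mult_nonneg_nonneg add_nonneg_nonneg nn b) simp_all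
      show ?thesis
        unfolding summand sum mult[OF nn(1)] mult[OF nn(2)]
        by (subst ennreal_plus[symmetric] | intro add_nonneg_nonneg sum_nonneg mult_nonneg_nonneg nn b divide_nonneg_nonneg
          | simp)+
    qed
    also have "\<dots> \<le> ennreal (b k n)"
      unfolding b_def by (intro ennreal_leI mlp_recursion_bound_real assms(1,2) \<open>n \<ge> 1\<close>)
    finally show ?thesis unfolding b_def .
  qed
qed

section \<open>Separating the random maps from the noise\<close>

lemma (in prob_space) distr_pair_eq_if_indep_set:
  assumes X: "X \<in> measurable M S" and W: "W \<in> measurable M T"
    and indep: "indep_set \<B> \<A>"
    and \<A>: "\<And>A. A \<in> sets S \<Longrightarrow> X -` A \<inter> space M \<in> \<A>"
    and \<B>: "\<And>B. B \<in> sets T \<Longrightarrow> W -` B \<inter> space M \<in> \<B>"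
  shows "distr M (S \<Otimes>\<^sub>M T) (\<lambda>\<omega>. (X \<omega>, W \<omega>)) = distr M S X \<Otimes>\<^sub>M distr M T W"
proof (rule pair_measure_eqI[symmetric])
  interpret X: prob_space "distr M S X" by (rule prob_space_distr[OF X])
  interpret W: prob_space "distr M T W" by (rule prob_space_distr[OF W])
  show "sigma_finite_measure (distr M S X)" "sigma_finite_measure (distr M T W)" ..
  \<comment> \<open>Rectangles determine the product of sigma-finite measures, and on a rectangle
    the claim is independence of one pair of events.\<close>
  fix A B assume "A \<in> sets (distr M S X)" "B \<in> sets (distr M T W)"
  then have AB: "A \<in> sets S" "B \<in> sets T" by simp_all
  have "emeasure (distr M (S \<Otimes>\<^sub>M T) (\<lambda>\<omega>. (X \<omega>, W \<omega>))) (A \<times> B)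
      = emeasure M ((\<lambda>\<omega>. (X \<omega>, W \<omega>)) -` (A \<times> B) \<inter> space M)"
    using AB by (intro emeasure_distr measurable_Pair X W) auto
  also have "(\<lambda>\<omega>. (X \<omega>, W \<omega>)) -` (A \<times> B) \<inter> space M = (X -` A \<inter> space M) \<inter> (W -` B \<inter> space M)"
    by auto
  also have "emeasure M \<dots> = emeasure M (X -` A \<inter> space M) * emeasure M (W -` B \<inter> space M)"
    using indep_setD[OF indep \<B>[OF AB(2)] \<A>[OF AB(1)]]
    by (simp add: emeasure_eq_measure ennreal_mult Int_commute mult.commute)
  also have "\<dots> = emeasure (distr M S X) A * emeasure (distr M T W) B"
    using AB X W by (simp add: emeasure_distr)
  finally show "emeasure (distr M S X) A * emeasure (distr M T W) B
      = emeasure (distr M (S \<Otimes>\<^sub>M T) (\<lambda>\<omega>. (X \<omega>, W \<omega>))) (A \<times> B)" by simp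
qed simp

text \<open>Each \<open>X i\<close> is measurable for the sigma-algebra generated by the family,
  hence so is the family as a map into the product space. This carries independence of generated
  sigma-algebras over to the whole noise family.\<close>

lemma vimage_family_in_generated_sets:
  assumes X: "\<And>i. i \<in> I \<Longrightarrow> X i \<in> measurable P N" and B: "B \<in> sets (PiM I (\<lambda>_. N))"
  shows "(\<lambda>\<omega>. \<lambda>i\<in>I. X i \<omega>) -` B \<inter> space P \<in> generated_sets P I N X"
proof -
  define \<G> where "\<G> = (\<Union>i\<in>I. {X i -` A \<inter> space P | A. A \<in> sets N})"
  define S where "S = sigma (space P) \<G>"
  have "\<G> \<subseteq> Pow (space P)" by (auto simp: \<G>_def)
  then have S: "space S = space P" "sets S = generated_sets P I N X"
    by (auto simp: S_def generated_sets_def \<G>_def space_measure_of sets_measure_of)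
  have "X i \<in> measurable S N" if "i \<in> I" for i
  proof (rule measurableI)
    fix \<omega> assume "\<omega> \<in> space S"
    then show "X i \<omega> \<in> space N" using measurable_space[OF X[OF that]] S by simp
  next
    fix A assume "A \<in> sets N"
    with that show "X i -` A \<inter> space S \<in> sets S"
      unfolding S generated_sets_def by (intro sigma_sets.Basic) auto
  qed
  then have "(\<lambda>\<omega>. \<lambda>i\<in>I. X i \<omega>) \<in> measurable S (PiM I (\<lambda>_. N))"
    by (rule measurable_restrict)
  from measurable_sets[OF this B] show ?thesis by (simp add: S)
qed

section \<open>The error recursion for one fixed sample base\<close>

locale mlp_error = mlp_scheme P Zs Z \<Phi> m Y
  for P :: "'w measure"
    and Zs :: "'z measure"
    and Z :: "int list \<Rightarrow> 'w \<Rightarrow> 'z"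
    and \<Phi> :: "nat \<Rightarrow> 'y \<times> 'y \<times> 'z \<Rightarrow> 'y::{banach, second_countable_topology}"
    and m :: nat
    and Y :: "int list \<Rightarrow> int \<Rightarrow> 'w \<Rightarrow> 'y" +
  fixes \<psi> :: "nat \<Rightarrow> 'w \<Rightarrow> ('y \<Rightarrow>\<^sub>L 'h::{real_inner, banach, second_countable_topology})"
    and c C :: real
    and y :: 'y
  assumes c: "c \<ge> 1"
    and \<psi>_measurable: "\<And>k. \<psi> k \<in> measurable P strong_algebra"
    and Z_\<psi>_indep: "indep_set (generated_sets P Theta Zs Z) (generated_sets P UNIV strong_algebra \<psi>)"
    and level_integrable: "\<And>l. integrable P (level l)"
    and \<psi>_\<Phi>_bound: "\<And>k. second_moment P (\<lambda>\<omega>. blinfun_apply (\<psi> k \<omega>) (\<Phi> 0 (0, 0, Z [0] \<omega>))) \<le> ennreal (C\<^sup>2 / fact k)"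
    and \<psi>_y_bound: "\<And>k. second_moment P (\<lambda>\<omega>. blinfun_apply (\<psi> k \<omega>) y) \<le> ennreal (C\<^sup>2 / fact k)"
    and \<Phi>_lipschitz: "\<And>k n u v. n \<ge> 1 \<Longrightarrow>
          second_moment P (\<lambda>\<omega>. blinfun_apply (\<psi> k \<omega>) (\<Phi> n (u, v, Z [0] \<omega>)))
            \<le> ennreal c * second_moment P (\<lambda>\<omega>. blinfun_apply (\<psi> (k + 1) \<omega>) (u - v))"
    and bias_bound: "\<And>k n. n \<ge> 1 \<Longrightarrow>
          second_moment P (\<lambda>\<omega>. blinfun_apply (\<psi> k \<omega>) (y - (\<Sum>l<n. \<integral>\<omega>'. level l \<omega>' \<partial>P)))
            \<le> ennreal c * second_moment P (\<lambda>\<omega>. blinfun_apply (\<psi> (k + 1) \<omega>) (Y [0] (int n - 1) \<omega> - y))"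
begin

abbreviation q :: "nat \<Rightarrow> 'y \<Rightarrow> ennreal"
  where "q k \<equiv> mean_sq (distr P strong_algebra (\<psi> k))"

lemma sigma_finite_distr_\<psi>: "sigma_finite_measure (distr P strong_algebra (\<psi> k))"
proof -
  interpret D: prob_space "distr P strong_algebra (\<psi> k)"
    by (rule prob_space_distr[OF \<psi>_measurable])
  show ?thesis ..
qed

lemmas distr_\<psi> = sigma_finite_distr_\<psi> sets_distr

lemma q_measurable: "f \<in> borel_measurable N \<Longrightarrow> (\<lambda>x. q k (f x)) \<in> borel_measurable N"
  by (rule mean_sq_measurable[OF distr_\<psi>])

text \<open>By independence the joint law of \<open>\<psi> k\<close> and the noise is a product. For
  an argument that is a function of the noise, \<open>\<psi> k\<close> can be integrated first,
  which produces the deterministic function \<open>q k\<close>.\<close>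

lemma second_moment_eq:
  assumes g: "g \<in> borel_measurable (PiM Theta (\<lambda>_. Zs))"
    and G: "\<And>\<omega>. \<omega> \<in> space P \<Longrightarrow> G \<omega> = g (\<lambda>\<theta>\<in>Theta. Z \<theta> \<omega>)"
  shows "second_moment P (\<lambda>\<omega>. blinfun_apply (\<psi> k \<omega>) (G \<omega>)) = (\<integral>\<^sup>+ \<omega>. q k (G \<omega>) \<partial>P)"
proof -
  let ?W = "\<lambda>\<omega>. \<lambda>\<theta>\<in>Theta. Z \<theta> \<omega>" and ?T = "PiM Theta (\<lambda>_. Zs)"
  let ?h = "\<lambda>p. ennreal ((norm (blinfun_apply (fst p) (g (snd p))))\<^sup>2)"
  have W: "?W \<in> measurable P ?T"
    by (intro measurable_restrict Z_measurable)
  interpret W: prob_space "distr P ?T ?W" by (rule prob_space_distr[OF W])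
  have g': "g \<in> borel_measurable (distr P ?T ?W)" using g by simp
  have h: "?h \<in> borel_measurable (strong_algebra \<Otimes>\<^sub>M ?T)"
    using measurable_norm_eval[OF refl g] by (simp add: case_prod_beta')
  have "second_moment P (\<lambda>\<omega>. blinfun_apply (\<psi> k \<omega>) (G \<omega>)) = (\<integral>\<^sup>+ \<omega>. ?h (\<psi> k \<omega>, ?W \<omega>) \<partial>P)"
    unfolding second_moment_def by (intro nn_integral_cong) (simp add: G)
  also have "\<dots> = (\<integral>\<^sup>+ p. ?h p \<partial>distr P (strong_algebra \<Otimes>\<^sub>M ?T) (\<lambda>\<omega>. (\<psi> k \<omega>, ?W \<omega>)))"
    by (rule nn_integral_distr'[symmetric, OF measurable_Pair[OF \<psi>_measurable W] h])
  also have "distr P (strong_algebra \<Otimes>\<^sub>M ?T) (\<lambda>\<omega>. (\<psi> k \<omega>, ?W \<omega>))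
      = distr P strong_algebra (\<psi> k) \<Otimes>\<^sub>M distr P ?T ?W"
  proof (rule distr_pair_eq_if_indep_set[OF \<psi>_measurable W])
    show "indep_set (generated_sets P Theta Zs Z) (generated_sets P UNIV strong_algebra \<psi>)"
      by (rule Z_\<psi>_indep)
    show "\<psi> k -` A \<inter> space P \<in> generated_sets P UNIV strong_algebra \<psi>" if "A \<in> sets strong_algebra" for A
      using that unfolding generated_sets_def by (intro sigma_sets.Basic) auto
  qed (rule vimage_family_in_generated_sets[OF Z_measurable])
  also have "(\<integral>\<^sup>+ p. ?h p \<partial>\<dots>) = (\<integral>\<^sup>+ \<phi>. \<integral>\<^sup>+ w. ?h (\<phi>, w) \<partial>distr P ?T ?W \<partial>distr P strong_algebra (\<psi> k))"
    using measurable_norm_eval[OF sets_distr g', of P "\<psi> k"]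
    by (intro W.nn_integral_fst[symmetric]) (simp add: case_prod_beta')
  also have "\<dots> = (\<integral>\<^sup>+ w. q k (g w) \<partial>distr P ?T ?W)"
    by (simp add: nn_integral_mean_sq[OF sigma_finite_distr_\<psi> W.sigma_finite_measure_axioms sets_distr g'])
  also have "\<dots> = (\<integral>\<^sup>+ \<omega>. q k (g (?W \<omega>)) \<partial>P)"
    by (rule nn_integral_distr'[OF W q_measurable[OF g]])
  also have "\<dots> = (\<integral>\<^sup>+ \<omega>. q k (G \<omega>) \<partial>P)"
    by (intro nn_integral_cong) (simp add: G)
  finally show ?thesis .
qed

lemma second_moment_const: "second_moment P (\<lambda>\<omega>. blinfun_apply (\<psi> k \<omega>) x) = q k x"
  using second_moment_eq[of "\<lambda>_. x" "\<lambda>_. x" k] by (simp add: emeasure_space_1)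

lemma second_moment_Y:
  "second_moment P (\<lambda>\<omega>. blinfun_apply (\<psi> k \<omega>) (Y [0] (int n) \<omega> - y)) = (\<integral>\<^sup>+ \<omega>. q k (Y [0] (int n) \<omega> - y) \<partial>P)"
proof (rule second_moment_eq)
  have "(\<lambda>w. mlp_val \<Phi> m n (\<lambda>\<eta>. w ([0] @ \<eta>))) \<in> borel_measurable (PiM Theta (\<lambda>_. Zs))"
    by (intro mlp_val_measurable[OF \<Phi>_measurable] measurable_component_singleton) (simp add: Theta_def)
  then show "(\<lambda>w. mlp_val \<Phi> m n (\<lambda>\<eta>. w ([0] @ \<eta>)) - y) \<in> borel_measurable (PiM Theta (\<lambda>_. Zs))"
    by (rule borel_measurable_diff) simp
qed (simp add: Y_eq_mlp_val Theta_def)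

lemma second_moment_\<Phi>:
  "second_moment P (\<lambda>\<omega>. blinfun_apply (\<psi> k \<omega>) (\<Phi> l (u, v, Z [0] \<omega>))) = (\<integral>\<^sup>+ \<omega>. q k (\<Phi> l (u, v, Z [0] \<omega>)) \<partial>P)"
proof (rule second_moment_eq)
  show "(\<lambda>w. \<Phi> l (u, v, w [0])) \<in> borel_measurable (PiM Theta (\<lambda>_. Zs))"
    by (intro measurable_pair3[OF \<Phi>_measurable] measurable_component_singleton)
      (simp_all add: Theta_def)
qed (simp add: Theta_def)

lemma level_0_le: "(\<integral>\<^sup>+ \<omega>. q k (level 0 \<omega>) \<partial>P) \<le> ennreal (C\<^sup>2 / fact k)"
proof -
  have "(\<integral>\<^sup>+ \<omega>. q k (level 0 \<omega>) \<partial>P) = (\<integral>\<^sup>+ \<omega>. q k (\<Phi> 0 (0, 0, Z [0] \<omega>)) \<partial>P)"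
    using Y_init by (intro nn_integral_cong) (simp add: level_def Theta_def)
  with \<psi>_\<Phi>_bound[of k] show ?thesis by (simp add: second_moment_\<Phi>)
qed

lemma level_le:
  assumes "l \<ge> 1"
  shows "(\<integral>\<^sup>+ \<omega>. q k (level l \<omega>) \<partial>P) \<le> ennreal c *
    (2 * (\<integral>\<^sup>+ \<omega>. q (Suc k) (Y [0] (int l) \<omega> - y) \<partial>P) + 2 * (\<integral>\<^sup>+ \<omega>. q (Suc k) (Y [0] (int (l - 1)) \<omega> - y) \<partial>P))"
proof -
  have th: "[0] \<in> Theta" "[1] \<in> Theta" by (simp_all add: Theta_def)
  have l: "int l - 1 = int (l - 1)" using assms by (simp add: of_nat_diff)
  have m0: "(\<lambda>\<omega>. q (Suc k) (Y [0] (int l) \<omega> - y)) \<in> borel_measurable P"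
    and m1: "(\<lambda>\<omega>. q (Suc k) (Y [1] (int l - 1) \<omega> - y)) \<in> borel_measurable P"
    unfolding l by (intro q_measurable borel_measurable_diff Y_measurable th borel_measurable_const)+
  have "(\<integral>\<^sup>+ \<omega>. q k (level l \<omega>) \<partial>P)
      = (\<integral>\<^sup>+ \<omega>. \<integral>\<^sup>+ \<omega>'. q k (\<Phi> l (Y [0] (int l) \<omega>, Y [1] (int l - 1) \<omega>, Z [0] \<omega>')) \<partial>P \<partial>P)"
    by (rule nn_integral_level) (rule q_measurable, simp)
  also have "\<dots> \<le> (\<integral>\<^sup>+ \<omega>. ennreal c * (2 * q (Suc k) (Y [0] (int l) \<omega> - y) + 2 * q (Suc k) (Y [1] (int l - 1) \<omega> - y)) \<partial>P)"
  proof (rule nn_integral_mono)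
    fix \<omega>
    have "(\<integral>\<^sup>+ \<omega>'. q k (\<Phi> l (Y [0] (int l) \<omega>, Y [1] (int l - 1) \<omega>, Z [0] \<omega>')) \<partial>P)
        \<le> ennreal c * q (Suc k) (Y [0] (int l) \<omega> - Y [1] (int l - 1) \<omega>)"
      using \<Phi>_lipschitz[OF assms] by (simp add: second_moment_\<Phi> second_moment_const)
    also have "\<dots> \<le> ennreal c * (2 * q (Suc k) (Y [0] (int l) \<omega> - y) + 2 * q (Suc k) (Y [1] (int l - 1) \<omega> - y))"
      by (intro mult_left_mono mean_sq_diff_le) simp_all
    finally show "(\<integral>\<^sup>+ \<omega>'. q k (\<Phi> l (Y [0] (int l) \<omega>, Y [1] (int l - 1) \<omega>, Z [0] \<omega>')) \<partial>P)
        \<le> ennreal c * (2 * q (Suc k) (Y [0] (int l) \<omega> - y) + 2 * q (Suc k) (Y [1] (int l - 1) \<omega> - y))" .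
  qed
  also have "\<dots> = ennreal c * (2 * (\<integral>\<^sup>+ \<omega>. q (Suc k) (Y [0] (int l) \<omega> - y) \<partial>P)
      + 2 * (\<integral>\<^sup>+ \<omega>. q (Suc k) (Y [1] (int l - 1) \<omega> - y) \<partial>P))"
    using m0 m1 by (simp add: nn_integral_cmult nn_integral_add)
  \<comment> \<open>The approximation rooted at 1 is replaced by the one rooted at 0, which has the
    same law, so that the bound only involves errors of the form in the recursion.\<close>
  finally show ?thesis
    by (simp only: nn_integral_mean_sq_Y_1[OF sigma_finite_distr_\<psi> sets_distr assms])
qed

lemma second_moment_Y_le:
  "second_moment P (\<lambda>\<omega>. blinfun_apply (\<psi> k \<omega>) (Y [0] (int n) \<omega> - y))
    \<le> ennreal (C\<^sup>2 * (8 * c / real m) ^ n * exp_tail (real m) k)"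
  unfolding second_moment_Y
proof (rule mlp_recursion_bound)
  fix k
  have "(\<integral>\<^sup>+ \<omega>. q k (Y [0] (int 0) \<omega> - y) \<partial>P) = (\<integral>\<^sup>+ \<omega>. q k y \<partial>P)"
    using Y_init by (intro nn_integral_cong) (simp add: Theta_def mean_sq_minus)
  with \<psi>_y_bound[of k]
  show "(\<integral>\<^sup>+ \<omega>. q k (Y [0] (int 0) \<omega> - y) \<partial>P) \<le> ennreal (C\<^sup>2 / fact k)"
    by (simp add: second_moment_const emeasure_space_1)
next
  fix k n :: nat
  assume n: "n \<ge> 1"
  let ?e = "\<lambda>k n. \<integral>\<^sup>+ \<omega>. q k (Y [0] (int n) \<omega> - y) \<partial>P"
  let ?v = "\<lambda>l. \<integral>\<^sup>+ \<omega>. q k (level l \<omega>) \<partial>P"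
  have n': "int n - 1 = int (n - 1)" using n by (simp add: of_nat_diff)
  have "?e k n \<le> q k (y - (\<Sum>l<n. \<integral>\<omega>. level l \<omega> \<partial>P)) + (\<Sum>l<n. ennreal (1 / real m ^ (n - l)) * ?v l)"
    by (rule mean_sq_Y_le[OF sigma_finite_distr_\<psi> sets_distr level_integrable n])
  \<comment> \<open>Level 0 is split off: the Lipschitz hypothesis starts at level 1, whereas level
    0 is controlled by the hypothesis on \<Phi> at the origin.\<close>
  also have "(\<Sum>l<n. ennreal (1 / real m ^ (n - l)) * ?v l)
      = ennreal (1 / real m ^ n) * ?v 0 + (\<Sum>l=1..<n. ennreal (1 / real m ^ (n - l)) * ?v l)"
    using n by (simp add: lessThan_atLeast0 sum.atLeast_Suc_lessThan)
  also have "q k (y - (\<Sum>l<n. \<integral>\<omega>. level l \<omega> \<partial>P)) + \<dots>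
      \<le> ennreal c * ?e (Suc k) (n - 1) + (ennreal (1 / real m ^ n) * ennreal (C\<^sup>2 / fact k)
      + (\<Sum>l=1..<n. ennreal (1 / real m ^ (n - l)) * (ennreal c * (2 * ?e (Suc k) l + 2 * ?e (Suc k) (l - 1)))))"
  proof (intro add_mono sum_mono mult_left_mono level_0_le level_le)
    show "q k (y - (\<Sum>l<n. \<integral>\<omega>. level l \<omega> \<partial>P)) \<le> ennreal c * ?e (Suc k) (n - 1)"
      using bias_bound[OF n, of k] unfolding second_moment_const n' second_moment_Y by simp
  qed auto
  finally show "?e k n \<le> ennreal c * ?e (Suc k) (n - 1) + ennreal (1 / real m ^ n) * ennreal (C\<^sup>2 / fact k)
      + (\<Sum>l=1..<n. ennreal (1 / real m ^ (n - l)) * (ennreal c * (2 * ?e (Suc k) l + 2 * ?e (Suc k) (l - 1))))"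
    by (simp only: add.assoc)
qed (use c m_pos in simp_all)

end

section \<open>Cost and complexity\<close>

text \<open>After the induction hypothesis is inserted and \<open>x ^ n * z\<close> is factored out,
  the claim becomes a numerical inequality in which the base 5 dominates the two previous costs and
  the constant 2.\<close>

lemma mlp_cost_bound:
  fixes Cost :: "int \<Rightarrow> real" and x z :: real
  assumes "x \<ge> 1" "z \<ge> 0"
    and init: "Cost (-1) = 0" "Cost 0 = 0"
    and rec: "\<And>n. n \<ge> 1 \<Longrightarrow> Cost (int n) \<le> x ^ n * z
      + (\<Sum>l<n. x ^ (n - l) * (Cost (int l) + Cost (int l - 1) + 2 * z))"
  shows "Cost (int n) \<le> (5 * x) ^ n * z"
proof (induction n rule: less_induct)
  case (less n)
  \<comment> \<open>\<open>g l\<close> bounds the contribution of level \<open>l\<close> in units of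
    \<open>x ^ n * z\<close>. At level 0 both costs vanish and only the 2 remains.\<close>
  define g :: "nat \<Rightarrow> real" where "g l = (if l = 0 then 2 else 5 ^ l + 5 ^ (l - 1) + 2)" for l
  have g_sum: "1 + (\<Sum>l<k. g l) \<le> 5 ^ k" if "k \<ge> 1" for k
    using that
  proof (induction k rule: nat_induct_at_least)
    case (Suc k)
    then obtain j where k: "k = Suc j" by (cases k) auto
    have "(5::real) ^ j \<ge> 1" by (rule one_le_power) simp
    have "1 + (\<Sum>l<Suc k. g l) \<le> 5 ^ k + (5 ^ k + 5 ^ (k - 1) + 2)"
      using Suc.IH Suc.hyps by (simp add: g_def)
    also have "\<dots> \<le> 5 ^ Suc k"
      using \<open>(5::real) ^ j \<ge> 1\<close> unfolding k power_Suc diff_Suc_1 by linarith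
    finally show ?case .
  qed (simp add: g_def)
  have step: "x ^ (n - l) * (Cost (int l) + Cost (int l - 1) + 2 * z) \<le> x ^ n * z * g l" if "l < n" for l
  proof (cases l)
    case 0
    then show ?thesis by (simp add: g_def init)
  next
    case (Suc j)
    have "Cost (int l) \<le> (5 * x) ^ l * z" "Cost (int l - 1) \<le> (5 * x) ^ j * z"
      using less.IH[of l] less.IH[of j] that Suc by simp_all
    then have "x ^ (n - l) * (Cost (int l) + Cost (int l - 1) + 2 * z)
        \<le> x ^ (n - l) * ((5 * x) ^ l * z + (5 * x) ^ j * z + 2 * z)"
      using \<open>x \<ge> 1\<close> by (intro mult_left_mono add_mono) auto
    also have "\<dots> = (x ^ (n - l) * x ^ l) * (5 ^ l * z) + (x ^ (n - l) * x ^ j) * (5 ^ j * z) + x ^ (n - l) * (2 * z)"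
      by (simp add: power_mult_distrib algebra_simps)
    also have "\<dots> \<le> x ^ n * (5 ^ l * z) + x ^ n * (5 ^ j * z) + x ^ n * (2 * z)"
      unfolding power_add[symmetric] using assms(1,2) that Suc
      by (intro add_mono mult_right_mono power_increasing) auto
    also have "\<dots> = x ^ n * z * g l"
      using Suc by (simp add: g_def algebra_simps)
    finally show ?thesis .
  qed
  show ?case
  proof (cases "n = 0")
    case True
    then show ?thesis using init \<open>z \<ge> 0\<close> by simp
  next
    case False
    then have "n \<ge> 1" by simp
    from rec[OF this] have "Cost (int n) \<le> x ^ n * z + (\<Sum>l<n. x ^ n * z * g l)"
      using sum_mono[of "{..<n}", OF step] by fastforce
    also have "\<dots> = x ^ n * z * (1 + (\<Sum>l<n. g l))"
      by (simp add: algebra_simps sum_distrib_left)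
    also have "\<dots> \<le> x ^ n * z * 5 ^ n"
      using assms(1,2) g_sum[OF \<open>n \<ge> 1\<close>] by (intro mult_left_mono) auto
    finally show ?thesis by (simp add: power_mult_distrib algebra_simps)
  qed
qed

section \<open>From error and cost bounds to complexity\<close>

lemma ennsqrt_le:
  assumes "x \<le> ennreal (b\<^sup>2)" "b \<ge> 0"
  shows "ennsqrt x \<le> ennreal b"
proof -
  have "x \<noteq> \<top>" using assms(1) by (auto simp: top_unique)
  moreover have "sqrt (enn2real x) \<le> b"
    using enn2real_mono[OF assms(1)] assms(2) by (simp add: real_le_lsqrt)
  ultimately show ?thesis by (simp add: ennsqrt_def ennreal_leI)
qed

text \<open>The base is at most (\<epsilon>/C)^2 \<le> 1, so lowering the exponent from n/2 to 1/2
  only enlarges the power, and the square root gives \<epsilon>/C.\<close>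

lemma rate_le_if_large:
  fixes C a x \<epsilon> :: real
  assumes "C > 0" "a > 0" "\<epsilon> > 0" "\<epsilon> \<le> C" and x: "x \<ge> a * (C / \<epsilon>)\<^sup>2" and "n \<ge> 1"
  shows "C * (a / x) powr (real n / 2) \<le> \<epsilon>"
proof -
  have "x > 0"
    using assms by (intro less_le_trans[OF _ x]) simp
  have r: "a / x \<le> (\<epsilon> / C)\<^sup>2"
    using assms \<open>x > 0\<close> by (simp add: field_simps power2_eq_square)
  have "(\<epsilon> / C)\<^sup>2 \<le> 1"
    using assms by (intro power_le_one) auto
  with r have "a / x \<le> 1" by linarith
  then have "(a / x) powr (real n / 2) \<le> (a / x) powr (1 / 2)"
    using \<open>n \<ge> 1\<close> \<open>a > 0\<close> \<open>x > 0\<close> by (intro powr_mono') auto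
  also have "\<dots> = sqrt (a / x)"
    using \<open>a > 0\<close> \<open>x > 0\<close> by (simp add: powr_half_sqrt)
  also have "\<dots> \<le> \<epsilon> / C"
    using r assms by (intro real_le_lsqrt) auto
  finally show ?thesis
    using \<open>C > 0\<close> by (simp add: field_simps)
qed

text \<open>From some index on the powers are at most 1; the finitely many earlier ones are bounded
  by their sum.\<close>

lemma finite_SUP_powers:
  fixes T :: "nat \<Rightarrow> real"
  assumes "\<And>n. T n \<ge> 0" and "eventually (\<lambda>n. T n \<le> 1) sequentially"
  shows "(SUP n\<in>A. ennreal (T n ^ n)) < \<top>"
proof -
  obtain n0 where n0: "\<And>n. n \<ge> n0 \<Longrightarrow> T n \<le> 1"
    using assms(2) by (auto simp: eventually_sequentially)
  have "T n ^ n \<le> 1 + (\<Sum>k<n0. T k ^ k)" for n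
  proof (cases "n < n0")
    case True
    then have "T n ^ n \<le> (\<Sum>k<n0. T k ^ k)"
      using assms(1) by (intro member_le_sum[of n]) auto
    then show ?thesis by simp
  next
    case False
    then have "T n ^ n \<le> 1" using assms(1) n0 by (intro power_le_one) auto
    moreover have "0 \<le> (\<Sum>k<n0. T k ^ k)" using assms(1) by (intro sum_nonneg) auto
    ultimately show ?thesis by simp
  qed
  then have "(SUP n\<in>A. ennreal (T n ^ n)) \<le> ennreal (1 + (\<Sum>k<n0. T k ^ k))"
    by (intro SUP_least ennreal_leI)
  also have "\<dots> < \<top>" by simp
  finally show ?thesis .
qed

text \<open>The failure of the error bound at level \<open>n\<close> says that
  \<open>1 < (C / \<epsilon>)\<^sup>2 (8 c exp \<kappa> / M)\<^sup>n\<close>; the \<open>(1 + \<delta>)\<close>-th power of the right-hand side is inserted as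
  a factor into the cost of level \<open>n + 1\<close>.\<close>

lemma cost_le_if_error_large:
  fixes C c \<BB> \<kappa> \<zz> \<epsilon> \<delta> x x' :: real
  assumes const: "\<zz> \<ge> 1" "\<BB> \<ge> 1" "\<kappa> \<ge> 1" "C \<ge> 1" "c \<ge> 1" and "\<epsilon> > 0" "\<delta> > 0"
    and x: "x \<ge> 1" "x' \<ge> 0" "x' \<le> \<BB> * x" "x' \<le> \<kappa> * real (Suc n)"
    and large: "C * (8 * c * exp \<kappa> / x) powr (real n / 2) > \<epsilon>"
  shows "(5 * x') ^ Suc n * \<zz> \<le> 5 * \<zz> * exp \<kappa> * C powr (2 * (1 + \<delta>))
    * (x powr (- \<delta>) * (40 * c * exp (2 * \<kappa>) * \<BB>) powr (1 + \<delta>)) ^ n * \<epsilon> powr (- 2 * (1 + \<delta>))"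
proof -
  define r where "r = 8 * c * exp \<kappa> / x"
  define u where "u = 5 * \<BB> * exp \<kappa>"
  have "r > 0" using const x by (simp add: r_def)
  have "u \<ge> 1" using const mult_mono[of 1 "5 * \<BB>" 1 "exp \<kappa>"] by (simp add: u_def)
  have "C / \<epsilon> * r powr (real n / 2) \<ge> 1"
    using large \<open>\<epsilon> > 0\<close> by (simp add: r_def field_simps)
  then have "1 \<le> (C / \<epsilon> * r powr (real n / 2)) powr (2 * (1 + \<delta>))"
    using \<open>\<delta> > 0\<close> by (intro ge_one_powr_ge_zero) auto
  also have "\<dots> = C powr (2 * (1 + \<delta>)) * \<epsilon> powr (- 2 * (1 + \<delta>)) * (r powr (real n / 2)) powr (2 * (1 + \<delta>))"
  proof -
    have "(C / \<epsilon>) powr (2 * (1 + \<delta>)) = C powr (2 * (1 + \<delta>)) * \<epsilon> powr (- 2 * (1 + \<delta>))"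
      using const \<open>\<epsilon> > 0\<close> powr_minus[of \<epsilon> "2 * (1 + \<delta>)"] by (simp add: powr_divide inverse_eq_divide)
    then show ?thesis
      by (simp only: powr_mult)
  qed
  also have "(r powr (real n / 2)) powr (2 * (1 + \<delta>)) = (r powr (1 + \<delta>)) ^ n"
  proof -
    have "(r powr (1 + \<delta>)) ^ n = (r powr (1 + \<delta>)) powr real n"
      using \<open>r > 0\<close> by (simp add: powr_realpow)
    then show ?thesis by (simp add: powr_powr algebra_simps)
  qed
  finally have one: "1 \<le> C powr (2 * (1 + \<delta>)) * \<epsilon> powr (- 2 * (1 + \<delta>)) * (r powr (1 + \<delta>)) ^ n" .
  \<comment> \<open>Of the n + 1 factors \<open>x'\<close> in the cost, one is bounded through
    linear growth by an exponential; the other n are compared with \<open>x\<close> through the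
    ratio bound.\<close>
  have "x' \<le> exp (\<kappa> * real (Suc n))"
    using x(4) exp_ge_add_one_self[of "\<kappa> * real (Suc n)"] by linarith
  also have "\<dots> = exp \<kappa> * exp \<kappa> ^ n"
    using exp_of_nat2_mult[of \<kappa> n] by (simp add: distrib_left exp_add)
  finally have x': "x' \<le> exp \<kappa> * exp \<kappa> ^ n" .
  have "(5 * x') ^ Suc n * \<zz> = 5 * \<zz> * x' * (5 * x') ^ n"
    by simp
  also have "\<dots> \<le> 5 * \<zz> * (exp \<kappa> * exp \<kappa> ^ n) * (5 * (\<BB> * x)) ^ n"
    using x x' const by (intro mult_mono mult_left_mono power_mono) auto
  also have "\<dots> = 5 * \<zz> * exp \<kappa> * (u * x) ^ n * 1"
    by (simp add: u_def power_mult_distrib)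
  also have "\<dots> \<le> 5 * \<zz> * exp \<kappa> * (u * x) ^ n
      * (C powr (2 * (1 + \<delta>)) * \<epsilon> powr (- 2 * (1 + \<delta>)) * (r powr (1 + \<delta>)) ^ n)"
    using one const x \<open>u \<ge> 1\<close> by (intro mult_left_mono) auto
  also have "\<dots> = 5 * \<zz> * exp \<kappa> * C powr (2 * (1 + \<delta>)) * (u * x * r powr (1 + \<delta>)) ^ n * \<epsilon> powr (- 2 * (1 + \<delta>))"
    by (simp add: power_mult_distrib)
  also have "\<dots> \<le> 5 * \<zz> * exp \<kappa> * C powr (2 * (1 + \<delta>))
    * (x powr (- \<delta>) * (40 * c * exp (2 * \<kappa>) * \<BB>) powr (1 + \<delta>)) ^ n * \<epsilon> powr (- 2 * (1 + \<delta>))"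
  proof (intro mult_right_mono mult_left_mono power_mono)
    \<comment> \<open>\<open>r powr (1 + \<delta>)\<close> contains x^(-1-\<delta>). The factor
      \<open>x\<close> coming from the cost cancels one power and leaves x^(-\<delta>).\<close>
    have "x * r powr (1 + \<delta>) = x powr (- \<delta>) * (8 * c * exp \<kappa>) powr (1 + \<delta>)"
      using x const by (simp add: r_def powr_divide powr_minus powr_add field_simps)
    then have "u * x * r powr (1 + \<delta>) = x powr (- \<delta>) * (u * (8 * c * exp \<kappa>) powr (1 + \<delta>))"
      by (simp add: mult_ac)
    \<comment> \<open>Since \<open>u \<ge> 1\<close>, it may be raised to the power 1 + \<delta>,
      which lets the constants merge under one exponent.\<close>
    also have "\<dots> \<le> x powr (- \<delta>) * (u powr (1 + \<delta>) * (8 * c * exp \<kappa>) powr (1 + \<delta>))"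
      using powr_mono[of 1 "1 + \<delta>" u] \<open>u \<ge> 1\<close> \<open>\<delta> > 0\<close> by (intro mult_left_mono mult_right_mono) auto
    also have "u powr (1 + \<delta>) * (8 * c * exp \<kappa>) powr (1 + \<delta>) = (u * (8 * c * exp \<kappa>)) powr (1 + \<delta>)"
      using \<open>u \<ge> 1\<close> const by (simp add: powr_mult)
    also have "u * (8 * c * exp \<kappa>) = 40 * c * exp (2 * \<kappa>) * \<BB>"
      using exp_add[of \<kappa> \<kappa>] by (simp add: u_def)
    finally show "u * x * r powr (1 + \<delta>) \<le> x powr (- \<delta>) * (40 * c * exp (2 * \<kappa>) * \<BB>) powr (1 + \<delta>)" .
  qed (use const x \<open>u \<ge> 1\<close> in auto)
  finally show ?thesis .
qed

lemma complexity_from_error_and_cost: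
  fixes M :: "nat \<Rightarrow> nat" and \<zz> \<BB> \<kappa> C c :: real and err :: "nat \<Rightarrow> ennreal" and cost :: "nat \<Rightarrow> real"
  assumes const: "\<zz> \<ge> 1" "\<BB> \<ge> 1" "\<kappa> \<ge> 1" "C \<ge> 1" "c \<ge> 1"
    and M_pos: "\<And>j. j \<ge> 1 \<Longrightarrow> M j \<ge> 1"
    and M_lim: "filterlim (\<lambda>n. real (M n)) at_top sequentially"
    and M_ratio: "\<And>j. j \<ge> 1 \<Longrightarrow> real (M (Suc j)) \<le> \<BB> * real (M j)"
    and M_growth: "\<And>j. j \<ge> 1 \<Longrightarrow> real (M j) \<le> \<kappa> * real j"
    and err: "\<And>n. n \<ge> 1 \<Longrightarrow> err n \<le> ennreal (C * (8 * c * exp \<kappa> / real (M n)) powr (real n / 2))"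
    and cost: "\<And>n. n \<ge> 1 \<Longrightarrow> cost n \<le> (5 * real (M n)) ^ n * \<zz>"
  shows "\<exists>N :: real \<Rightarrow> nat.
            (\<forall>\<epsilon>\<in>{0<..1}. N \<epsilon> \<ge> 1) \<and>
            (\<forall>\<epsilon>\<in>{0<..1}. \<forall>\<delta>>0.
               (SUP n\<in>{N \<epsilon>..}. err n) \<le> ennreal \<epsilon> \<and>
               ennreal (cost (N \<epsilon>))
                 \<le> ennreal (5 * \<zz> * exp \<kappa> * C powr (2 * (1 + \<delta>))) *
                   (1 + (SUP n\<in>{1..}. ennreal
                      ((real (M n) powr (- \<delta>) * (40 * c * exp (2 * \<kappa>) * \<BB>) powr (1 + \<delta>)) ^ n))) *
                   ennreal (\<epsilon> powr (- 2 * (1 + \<delta>))) \<and>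
               ennreal (5 * \<zz> * exp \<kappa> * C powr (2 * (1 + \<delta>))) *
                   (1 + (SUP n\<in>{1..}. ennreal
                      ((real (M n) powr (- \<delta>) * (40 * c * exp (2 * \<kappa>) * \<BB>) powr (1 + \<delta>)) ^ n))) *
                   ennreal (\<epsilon> powr (- 2 * (1 + \<delta>))) < \<top>)"
proof -
  define b where "b n = C * (8 * c * exp \<kappa> / real (M n)) powr (real n / 2)" for n
  \<comment> \<open>Goodness refers to the explicit bound \<open>b\<close> instead of the error
    itself: failure then yields the lower bound on \<open>b\<close> that controls the cost. The
    choice of \<open>N\<close> does not involve \<delta>, as the order of quantifiers
    demands.\<close>
  define good where "good \<epsilon> N \<longleftrightarrow> N \<ge> 1 \<and> (\<forall>n\<ge>N. b n \<le> \<epsilon>)" for \<epsilon> N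
  define N where "N \<epsilon> = (LEAST N. good \<epsilon> N)" for \<epsilon>
  have "\<exists>N. good \<epsilon> N" if \<epsilon>: "\<epsilon> \<in> {0<..1}" for \<epsilon>
  proof -
    obtain n0 where n0: "\<And>n. n \<ge> n0 \<Longrightarrow> real (M n) \<ge> 8 * c * exp \<kappa> * (C / \<epsilon>)\<^sup>2"
      using M_lim by (auto simp: filterlim_at_top eventually_sequentially)
    have "good \<epsilon> (max n0 1)"
      unfolding good_def b_def using \<epsilon> const n0 by (auto intro!: rate_le_if_large)
    then show ?thesis ..
  qed
  then have N: "good \<epsilon> (N \<epsilon>)" if "\<epsilon> \<in> {0<..1}" for \<epsilon>
    unfolding N_def using that by (meson LeastI_ex)
  have err_N: "(SUP n\<in>{N \<epsilon>..}. err n) \<le> ennreal \<epsilon>" if "\<epsilon> \<in> {0<..1}" for \<epsilon>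
  proof (rule SUP_least)
    fix n assume "n \<in> {N \<epsilon>..}"
    then have "n \<ge> 1" "b n \<le> \<epsilon>" using N[OF that] by (auto simp: good_def)
    then show "err n \<le> ennreal \<epsilon>"
      using err[of n] unfolding b_def by (meson ennreal_leI order_trans)
  qed
  define A where "A \<delta> = 5 * \<zz> * exp \<kappa> * C powr (2 * (1 + \<delta>))" for \<delta>
  define T where "T \<delta> n = real (M n) powr (- \<delta>) * (40 * c * exp (2 * \<kappa>) * \<BB>) powr (1 + \<delta>)" for \<delta> n
  have T_nonneg: "T \<delta> n \<ge> 0" for \<delta> n by (simp add: T_def)
  have A: "A \<delta> \<ge> 5 * \<zz> * exp \<kappa>" if "\<delta> > 0" for \<delta>
    using const that mult_left_mono[OF ge_one_powr_ge_zero[of C "2 * (1 + \<delta>)"], of "5 * \<zz> * exp \<kappa>"]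
    by (simp add: A_def)
  have sup_fin: "(SUP n\<in>{1..}. ennreal (T \<delta> n ^ n)) < \<top>" if "\<delta> > 0" for \<delta>
  proof (rule finite_SUP_powers[OF T_nonneg])
    have "((\<lambda>n. T \<delta> n) \<longlongrightarrow> 0 * (40 * c * exp (2 * \<kappa>) * \<BB>) powr (1 + \<delta>)) sequentially"
      unfolding T_def using that by (intro tendsto_mult tendsto_neg_powr M_lim tendsto_const) auto
    then have "eventually (\<lambda>n. T \<delta> n < 1) sequentially"
      by (rule order_tendstoD) simp
    then show "eventually (\<lambda>n. T \<delta> n \<le> 1) sequentially"
      by eventually_elim simp
  qed
  have cost_N: "ennreal (cost (N \<epsilon>)) \<le> ennreal (A \<delta>) * (1 + (SUP n\<in>{1..}. ennreal (T \<delta> n ^ n)))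
      * ennreal (\<epsilon> powr (- 2 * (1 + \<delta>)))" if \<epsilon>: "\<epsilon> \<in> {0<..1}" and \<delta>: "\<delta> > 0" for \<epsilon> \<delta>
  proof -
    let ?E = "\<epsilon> powr (- 2 * (1 + \<delta>))"
    have "A \<delta> \<ge> 0" using A[OF \<delta>] const by (smt (verit) exp_gt_zero mult_pos_pos)
    \<comment> \<open>For \<open>N \<epsilon> = 1\<close> there is no preceding level in the
      admissible range. The cost is then bounded directly by M_1 \<le> \<kappa> \<le> exp \<kappa>;
      this case accounts for the summand 1 next to the supremum.\<close>
    consider (one) "N \<epsilon> = 1" | (more) n where "N \<epsilon> = Suc n" "n \<ge> 1"
      using N[OF \<epsilon>] by (cases "N \<epsilon>") (auto simp: good_def Suc_le_eq)
    then show ?thesis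
    proof cases
      case one
      have E: "?E \<ge> 1" using \<epsilon> \<delta> powr_mono'[of "- 2 * (1 + \<delta>)" 0 \<epsilon>] by simp
      have "cost 1 \<le> 5 * \<zz> * real (M 1)" using cost[of 1] by (simp add: mult_ac)
      also have "\<dots> \<le> 5 * \<zz> * exp \<kappa>"
      proof (intro mult_left_mono)
        show "real (M 1) \<le> exp \<kappa>"
          using M_growth[of 1] exp_ge_add_one_self[of \<kappa>] by linarith
      qed (use const in auto)
      also have "\<dots> \<le> A \<delta>" by (rule A[OF \<delta>])
      finally have "ennreal (cost (N \<epsilon>)) \<le> ennreal (A \<delta>) * 1 * 1"
        using one by (simp add: ennreal_leI)
      also have "\<dots> \<le> ennreal (A \<delta>) * (1 + (SUP n\<in>{1..}. ennreal (T \<delta> n ^ n))) * ennreal ?E"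
        using E by (intro mult_mono) auto
      finally show ?thesis .
    next
      case more
      have "\<not> good \<epsilon> n" using not_less_Least[of n "good \<epsilon>"] more by (simp add: N_def)
      \<comment> \<open>Minimality gives a failure at some index from \<open>n\<close> on; all
        indices from \<open>Suc n\<close> on are good, so the failure is at \<open>n\<close>
        itself.\<close>
      then have large: "b n > \<epsilon>"
      proof -
        obtain k where k: "k \<ge> n" "\<not> b k \<le> \<epsilon>"
          using \<open>\<not> good \<epsilon> n\<close> more(2) by (auto simp: good_def)
        with N[OF \<epsilon>] more(1) have "\<not> k \<ge> Suc n" by (auto simp: good_def)
        with k have "k = n" by simp
        with k show ?thesis by simp
      qed
      have "cost (N \<epsilon>) \<le> (5 * real (M (Suc n))) ^ Suc n * \<zz>"
        using cost[of "N \<epsilon>"] more by simp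
      also have "\<dots> \<le> A \<delta> * T \<delta> n ^ n * ?E"
        unfolding A_def T_def using more const \<epsilon> \<delta> large M_pos[of n] M_ratio[of n] M_growth[of "Suc n"]
        by (intro cost_le_if_error_large) (auto simp: b_def)
      finally have "ennreal (cost (N \<epsilon>)) \<le> ennreal (A \<delta>) * ennreal (T \<delta> n ^ n) * ennreal ?E"
        using \<open>A \<delta> \<ge> 0\<close> T_nonneg[of \<delta> n] by (simp add: ennreal_mult[symmetric] ennreal_leI)
      also have "\<dots> \<le> ennreal (A \<delta>) * (1 + (SUP n\<in>{1..}. ennreal (T \<delta> n ^ n))) * ennreal ?E"
        using more SUP_upper[of n "{1..}" "\<lambda>n. ennreal (T \<delta> n ^ n)"]
        by (intro mult_right_mono mult_left_mono) (auto intro: add_increasing)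
      finally show ?thesis .
    qed
  qed
  have fin: "ennreal (A \<delta>) * (1 + (SUP n\<in>{1..}. ennreal (T \<delta> n ^ n)))
      * ennreal (\<epsilon> powr (- 2 * (1 + \<delta>))) < \<top>" if "\<delta> > 0" for \<epsilon> \<delta>
    using sup_fin[OF that] by (simp add: ennreal_mult_less_top)
  show ?thesis
    using N err_N cost_N fin unfolding A_def T_def by (intro exI[of _ N]) (auto simp: good_def)
qed

section \<open>The complexity theorem, on the diagonal where level and sample base share their
  index\<close>

theorem theorem1p1:
  fixes P :: "'w measure"
    and Zs :: "'z measure"
    and \<zz> \<BB> \<kappa> C c :: real
    and M :: "nat \<Rightarrow> nat"
    and y :: "'y::{banach, second_countable_topology}"
    and Z :: "int list \<Rightarrow> 'w \<Rightarrow> 'z"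
    and \<psi> :: "nat \<Rightarrow> 'w \<Rightarrow> ('y \<Rightarrow>\<^sub>L 'h::{real_inner, banach, second_countable_topology})"
    and \<Phi> :: "nat \<Rightarrow> 'y \<times> 'y \<times> 'z \<Rightarrow> 'y"
    and Y :: "int list \<Rightarrow> int \<Rightarrow> nat \<Rightarrow> 'w \<Rightarrow> 'y"
    and Cost :: "int \<Rightarrow> nat \<Rightarrow> real"
  assumes P: "prob_space P"
    and constants: "\<zz> \<ge> 1" "\<BB> \<ge> 1" "\<kappa> \<ge> 1" "C \<ge> 1" "c \<ge> 1"
    and M_pos: "\<And>j. j \<ge> 1 \<Longrightarrow> M j \<ge> 1"
    and M_liminf: "liminf (\<lambda>j. ereal (real (M j))) = \<infinity>"
    and M_ratio: "(SUP j\<in>{1..}. ereal (real (M (j + 1)) / real (M j))) \<le> ereal \<BB>"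
    and M_growth: "(SUP j\<in>{1..}. ereal (real (M j) / real j)) \<le> ereal \<kappa>"
    and Z_measurable: "\<And>\<theta>. \<theta> \<in> Theta \<Longrightarrow> Z \<theta> \<in> measurable P Zs"
    and Z_iid: "iid_family P Theta Zs Z"
    and \<psi>_measurable: "\<And>k. \<psi> k \<in> measurable P strong_algebra"
    and Z_\<psi>_indep: "prob_space.indep_set P
          (generated_sets P Theta Zs Z) (generated_sets P UNIV strong_algebra \<psi>)"
    and \<Phi>_measurable: "\<And>l. \<Phi> l \<in> measurable (borel \<Otimes>\<^sub>M borel \<Otimes>\<^sub>M Zs) borel"
    and Y_init: "\<And>\<theta> j \<omega>. \<theta> \<in> Theta \<Longrightarrow> j \<ge> 1 \<Longrightarrow> \<omega> \<in> space P \<Longrightarrow>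
          Y \<theta> (-1) j \<omega> = 0 \<and> Y \<theta> 0 j \<omega> = 0"
    and Y_rec: "\<And>\<theta> n j \<omega>. \<theta> \<in> Theta \<Longrightarrow> n \<ge> 1 \<Longrightarrow> j \<ge> 1 \<Longrightarrow> \<omega> \<in> space P \<Longrightarrow>
          Y \<theta> (int n) j \<omega> =
            (\<Sum>l<n. (1 / real (M j) ^ (n - l)) *\<^sub>R
              (\<Sum>i = 1..M j ^ (n - l).
                 \<Phi> l (Y (\<theta> @ [int l, int i]) (int l) j \<omega>,
                      Y (\<theta> @ [- int l, int i]) (int l - 1) j \<omega>,
                      Z (\<theta> @ [int l, int i]) \<omega>)))"
    and Cost_nonneg: "\<And>n j. n \<ge> -1 \<Longrightarrow> j \<ge> 1 \<Longrightarrow> Cost n j \<ge> 0"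
    and Cost_init: "\<And>j. j \<ge> 1 \<Longrightarrow> Cost (-1) j = 0 \<and> Cost 0 j = 0"
    and Cost_rec: "\<And>n j. n \<ge> 1 \<Longrightarrow> j \<ge> 1 \<Longrightarrow>
          Cost (int n) j \<le> real (M j) ^ n * \<zz> +
            (\<Sum>l<n. real (M j) ^ (n - l) * (Cost (int l) j + Cost (int l - 1) j + 2 * \<zz>))"
    and \<Phi>_integrable: "\<And>k j. j \<ge> 1 \<Longrightarrow>
          (\<integral>\<^sup>+ \<omega>. ennreal (norm (\<Phi> k (Y [0] (int k) j \<omega>, Y [1] (int k - 1) j \<omega>, Z [0] \<omega>))) \<partial>P) < \<top>"
    and \<psi>_bound: "\<And>k.
          max (second_moment P (\<lambda>\<omega>. blinfun_apply (\<psi> k \<omega>) (\<Phi> 0 (0, 0, Z [0] \<omega>))))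
              (second_moment P (\<lambda>\<omega>. blinfun_apply (\<psi> k \<omega>) y)) \<le> ennreal (C\<^sup>2 / fact k)"
    and \<Phi>_lipschitz: "\<And>k n u v. n \<ge> 1 \<Longrightarrow>
          second_moment P (\<lambda>\<omega>. blinfun_apply (\<psi> k \<omega>) (\<Phi> n (u, v, Z [0] \<omega>)))
            \<le> ennreal c * second_moment P (\<lambda>\<omega>. blinfun_apply (\<psi> (k + 1) \<omega>) (u - v))"
    and bias_bound: "\<And>k n j. n \<ge> 1 \<Longrightarrow> j \<ge> 1 \<Longrightarrow>
          second_moment P (\<lambda>\<omega>. blinfun_apply (\<psi> k \<omega>)
              (y - (\<Sum>l<n. \<integral>\<omega>'. \<Phi> l (Y [0] (int l) j \<omega>', Y [1] (int l - 1) j \<omega>', Z [0] \<omega>') \<partial>P)))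
            \<le> ennreal c * second_moment P (\<lambda>\<omega>. blinfun_apply (\<psi> (k + 1) \<omega>) (Y [0] (int n - 1) j \<omega> - y))"
  shows "(\<forall>n\<ge>1.
            ennsqrt (second_moment P (\<lambda>\<omega>. blinfun_apply (\<psi> 0 \<omega>) (Y [0] (int n) n \<omega> - y)))
              \<le> ennreal (C * (8 * c * exp \<kappa> / real (M n)) powr (real n / 2)) \<and>
            ennreal (C * (8 * c * exp \<kappa> / real (M n)) powr (real n / 2)) < \<top>) \<and>
         (\<forall>n\<ge>1. Cost (int n) n \<le> (5 * real (M n)) ^ n * \<zz>) \<and>
         (\<exists>N :: real \<Rightarrow> nat.
            (\<forall>\<epsilon>\<in>{0<..1}. N \<epsilon> \<ge> 1) \<and>
            (\<forall>\<epsilon>\<in>{0<..1}. \<forall>\<delta>>0.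
               (SUP n\<in>{N \<epsilon>..}.
                  ennsqrt (second_moment P (\<lambda>\<omega>. blinfun_apply (\<psi> 0 \<omega>) (Y [0] (int n) n \<omega> - y))))
                 \<le> ennreal \<epsilon> \<and>
               ennreal (Cost (int (N \<epsilon>)) (N \<epsilon>))
                 \<le> ennreal (5 * \<zz> * exp \<kappa> * C powr (2 * (1 + \<delta>))) *
                   (1 + (SUP n\<in>{1..}. ennreal
                      ((real (M n) powr (- \<delta>) * (40 * c * exp (2 * \<kappa>) * \<BB>) powr (1 + \<delta>)) ^ n))) *
                   ennreal (\<epsilon> powr (- 2 * (1 + \<delta>))) \<and>
               ennreal (5 * \<zz> * exp \<kappa> * C powr (2 * (1 + \<delta>))) *
                   (1 + (SUP n\<in>{1..}. ennreal
                      ((real (M n) powr (- \<delta>) * (40 * c * exp (2 * \<kappa>) * \<BB>) powr (1 + \<delta>)) ^ n))) *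
                   ennreal (\<epsilon> powr (- 2 * (1 + \<delta>))) < \<top>))"
proof -
  interpret prob_space P by (rule P)
  \<comment> \<open>The recursion in \<open>Y\<close> never changes \<open>j\<close>, so each
    \<open>j\<close> gives a scheme of its own with sample base \<open>M j\<close>. Only the final
    bounds set \<open>j = n\<close>.\<close>
  have scheme: "mlp_scheme P Zs Z \<Phi> (M j) (\<lambda>\<theta> n. Y \<theta> n j)" if "j \<ge> 1" for j
    using that
    by (intro mlp_scheme.intro mlp_scheme_axioms.intro P M_pos Z_measurable Z_iid \<Phi>_measurable Y_init Y_rec)
  have level: "mlp_scheme.level Z \<Phi> (\<lambda>\<theta> n. Y \<theta> n j) l
      = (\<lambda>\<omega>. \<Phi> l (Y [0] (int l) j \<omega>, Y [1] (int l - 1) j \<omega>, Z [0] \<omega>))" if "j \<ge> 1" for j l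
    by (intro ext mlp_scheme.level_def[OF scheme[OF that]])
  have error: "mlp_error P Zs Z \<Phi> (M j) (\<lambda>\<theta> n. Y \<theta> n j) \<psi> c C y" if j: "j \<ge> 1" for j
  proof (intro mlp_error.intro mlp_error_axioms.intro scheme[OF j] constants \<psi>_measurable Z_\<psi>_indep \<Phi>_lipschitz)
    fix l
    \<comment> \<open>Measurability together with the finite expected norm gives Bochner
      integrability, so the integrals in the bias hypothesis are genuine means.\<close>
    show "integrable P (mlp_scheme.level Z \<Phi> (\<lambda>\<theta> n. Y \<theta> n j) l)"
      using mlp_scheme.level_measurable[OF scheme[OF j]] \<Phi>_integrable[OF j, of l]
      unfolding level[OF j] by (intro integrableI_bounded) (simp_all add: level[OF j])
  next
    fix k
    show "second_moment P (\<lambda>\<omega>. blinfun_apply (\<psi> k \<omega>) (\<Phi> 0 (0, 0, Z [0] \<omega>))) \<le> ennreal (C\<^sup>2 / fact k)"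
      "second_moment P (\<lambda>\<omega>. blinfun_apply (\<psi> k \<omega>) y) \<le> ennreal (C\<^sup>2 / fact k)"
      using \<psi>_bound[of k] by simp_all
  next
    fix k n :: nat
    assume "n \<ge> 1"
    from bias_bound[OF this j, of k]
    show "second_moment P (\<lambda>\<omega>. blinfun_apply (\<psi> k \<omega>)
          (y - (\<Sum>l<n. \<integral>\<omega>'. mlp_scheme.level Z \<Phi> (\<lambda>\<theta> n. Y \<theta> n j) l \<omega>' \<partial>P)))
        \<le> ennreal c * second_moment P (\<lambda>\<omega>. blinfun_apply (\<psi> (k + 1) \<omega>) (Y [0] (int n - 1) j \<omega> - y))"
      by (simp only: level[OF j])
  qed
  have growth: "real (M j) \<le> \<kappa> * real j" if "j \<ge> 1" for j
  proof -
    have "ereal (real (M j) / real j) \<le> ereal \<kappa>"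
      using that by (intro order_trans[OF _ M_growth] SUP_upper) simp
    then show ?thesis using that by (simp add: field_simps)
  qed
  have ratio: "real (M (Suc j)) \<le> \<BB> * real (M j)" if "j \<ge> 1" for j
  proof -
    have "ereal (real (M (j + 1)) / real (M j)) \<le> ereal \<BB>"
      using that by (intro order_trans[OF _ M_ratio] SUP_upper) simp
    then show ?thesis using M_pos[OF that] by (simp add: field_simps)
  qed
  have lim: "filterlim (\<lambda>n. real (M n)) at_top sequentially"
  proof -
    \<comment> \<open>An infinite lower limit is the same as convergence to infinity.\<close>
    have "(\<lambda>n. ereal (real (M n))) \<longlonglongrightarrow> \<infinity>"
      using M_liminf by (intro Liminf_PInfty[THEN iffD2]) auto
    then show ?thesis by (simp add: tendsto_PInfty_eq_at_top)
  qed
  have err: "ennsqrt (second_moment P (\<lambda>\<omega>. blinfun_apply (\<psi> 0 \<omega>) (Y [0] (int n) n \<omega> - y)))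
      \<le> ennreal (C * (8 * c * exp \<kappa> / real (M n)) powr (real n / 2))" if n: "n \<ge> 1" for n
  proof (rule ennsqrt_le)
    let ?r = "8 * c * exp \<kappa> / real (M n)"
    have pos: "real (M n) > 0" "?r > 0" using M_pos[OF n] constants by simp_all
    \<comment> \<open>Here the diagonal choice matters: M_n \<le> \<kappa> n turns the factor
      exp(M_n) into an n-th power, which joins the rate.\<close>
    have "exp (real (M n)) \<le> exp \<kappa> ^ n"
      using growth[OF n] by (simp flip: exp_of_nat2_mult)
    then have "C\<^sup>2 * (8 * c / real (M n)) ^ n * exp (real (M n)) \<le> C\<^sup>2 * (8 * c / real (M n)) ^ n * exp \<kappa> ^ n"
      using constants by (intro mult_left_mono) auto
    also have "\<dots> = C\<^sup>2 * ?r ^ n"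
      by (simp add: power_mult_distrib power_divide)
    also have "?r ^ n = (?r powr (real n / 2))\<^sup>2"
    proof -
      have "?r ^ n = ?r powr real n" using pos(2) by (rule powr_realpow[symmetric])
      also have "\<dots> = ?r powr (real n / 2) * ?r powr (real n / 2)"
        by (simp only: powr_add[symmetric] field_sum_of_halves)
      finally show ?thesis by (simp only: power2_eq_square)
    qed
    also have "C\<^sup>2 * \<dots> = (C * ?r powr (real n / 2))\<^sup>2"
      by (simp only: power_mult_distrib)
    finally show "second_moment P (\<lambda>\<omega>. blinfun_apply (\<psi> 0 \<omega>) (Y [0] (int n) n \<omega> - y))
        \<le> ennreal ((C * ?r powr (real n / 2))\<^sup>2)"
      using mlp_error.second_moment_Y_le[OF error[OF n], of 0 n]
      unfolding exp_tail_0 by (meson ennreal_leI order_trans)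
    show "0 \<le> C * ?r powr (real n / 2)" using constants by simp
  qed
  have cost: "Cost (int n) n \<le> (5 * real (M n)) ^ n * \<zz>" if "n \<ge> 1" for n
    using M_pos[OF that] constants Cost_init[OF that] Cost_rec[OF _ that]
    by (intro mlp_cost_bound[where Cost = "\<lambda>k. Cost k n"]) auto
  show ?thesis
    using err cost complexity_from_error_and_cost[OF constants M_pos lim ratio growth err cost] by simp
qed

end
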